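(* Let $p\geq 3$ be a prime, let $\lambda\in\mathbb{C}_p$ be not a root of unity with $1/p<|1-\lambda|<1$, and let $f\in\mathcal{G}_{\lambda}$ be of the form $$f(x)=\lambda x+\sum_{i=2}^{\infty}a_ix^i\in\mathcal{O}_p[[x]],\qquad |a_2|=1 \text{ and } |a_2^2-a_3|=1.$$ Then the linearization disk $\Delta_f$ of $f$ equals the linearization disk $\Delta_{P_\lambda}$ of $P_\lambda(x)=\lambda x+x^2$, which is the open disk about $0$ of radius $r(P_\lambda)=|1-\lambda|^{-1/p}\,\tilde{r}(\lambda)$.
   Context: $\mathbb{C}_p$ is the completion of an algebraic closure of $\mathbb{Q}_p$, with absolute value normalized by $|p|=1/p$; $\mathcal{O}_p=\{x\in\mathbb{C}_p:|x|\le 1\}$. For $\lambda\in\mathbb{C}_p$ with $|\lambda|=1$, $\lambda$ not a root of unity, $\mathcal{G}_{\lambda}:=\lambda x+x^2\mathcal{O}_p[[x]]$. The linearization disk $\Delta_f$ of $f\in\mathcal{G}_\lambda$ is the maximal disk about the origin on which $f$ is analytically conjugate to $T_\lambda:x\mapsto\lambda x$ (via the power series $H_f$ with $H_f(0)=0$, $H_f'(0)=1$, $H_f\circ f=\lambda H_f$), and $r(f)$ denotes its exact radius. Definition of $\tilde r(\lambda)$. Put $R(0):=0$ and $R(j):=p^{-\frac{1}{p^{j-1}(p-1)}}$ for integers $j\ge 1$. Let $\Gamma_r$ be the group of roots of unity in $\mathbb{C}_p$ of order a power of $p$ (including $1$). Let $m=\min\{n\ge 1:|1-\lambda^n|<1\}$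 (so $m=1$ when $|1-\lambda|<1$), let $s\ge 0$ be the integer with $R(s)\le|1-\lambda^m|<R(s+1)$, let $\gamma_0\in\Gamma_r$ be an element minimizing $|\gamma_0-\lambda^m|$ over $\Gamma_r$, and let $t\ge 0$ be the integer with $R(t)\le|\gamma_0-\lambda^m|<R(t+1)$. Then $$\tilde r(\lambda):=R(s+1)^{\frac1m}\,p^{-\frac{s-t}{mp^s}}\,|1-\lambda^m|^{s\frac{p-1}{mp}}\,|\gamma_0-\lambda^m|^{\frac{1}{mp^{s-t}}}.$$ *)

theory Defs
  imports "HOL-Analysis.Elementary_Metric_Spaces"
    "HOL-Computational_Algebra.Polynomial"
    "HOL-Computational_Algebra.Formal_Power_Series"
begin

text \<open>
  Complete fields of characteristic zero with a non-archimedean absolute value, written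
  \<open>abs_val\<close>. Topology, balls, closures and series are the library notions for the
  metric \<open>dist x y = abs_val (x - y)\<close>. Positivity and definiteness of \<open>abs_val\<close> follow from
  the metric axioms.
\<close>

class nonarch_complete_field = field_char_0 + complete_space +
  fixes abs_val :: "'a \<Rightarrow> real"
  assumes dist_abs_val: "dist x y = abs_val (x - y)"
    and abs_val_mult: "abs_val (x * y) = abs_val x * abs_val y"
    and abs_val_add_le_max: "abs_val (x + y) \<le> max (abs_val x) (abs_val y)"

text \<open>
  If \<open>abs_val (of_nat p) = 1 / p\<close>, then \<open>abs_val\<close> restricts to the \<open>p\<close>-adic absolute value on
  \<open>\<rat>\<close>, and, the ambient field being complete, the closure of \<open>\<rat>\<close> is \<open>\<rat>\<^sub>p\<close>.
\<close>

definition padic_numbers :: "'a::nonarch_complete_field set" where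
  "padic_numbers = closure \<rat>"

definition padic_algebraic_numbers :: "'a::nonarch_complete_field set" where
  "padic_algebraic_numbers =
     {x. \<exists>P. P \<noteq> 0 \<and> (\<forall>i. coeff P i \<in> padic_numbers) \<and> poly P x = 0}"

text \<open>
  The type \<open>'a\<close> is the completion of an algebraic closure of \<open>\<rat>\<^sub>p\<close>: the elements algebraic
  over \<open>\<rat>\<^sub>p\<close> form an algebraically closed, dense subfield. This determines \<open>'a\<close> up to an
  isometric isomorphism.
\<close>

definition is_complex_padics :: "nat \<Rightarrow> 'a::nonarch_complete_field itself \<Rightarrow> bool" where
  "is_complex_padics p T \<longleftrightarrow>
     prime p \<and> abs_val (of_nat p :: 'a) = 1 / real p \<and>
     (\<forall>P :: 'a poly. degree P > 0 \<and> (\<forall>i. coeff P i \<in> padic_algebraic_numbers) \<longrightarrow>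
        (\<exists>x \<in> padic_algebraic_numbers. poly P x = 0)) \<and>
     closure (padic_algebraic_numbers :: 'a set) = UNIV"

definition fps_converges_on :: "'a::nonarch_complete_field fps \<Rightarrow> 'a set \<Rightarrow> bool" where
  "fps_converges_on F D \<longleftrightarrow> (\<forall>x\<in>D. summable (\<lambda>n. fps_nth F n * x ^ n))"

definition fps_value :: "'a::nonarch_complete_field fps \<Rightarrow> 'a \<Rightarrow> 'a" where
  "fps_value F x = (\<Sum>n. fps_nth F n * x ^ n)"

definition indifferent_series :: "'a::nonarch_complete_field \<Rightarrow> 'a fps set" where
  "indifferent_series l =
     {f. fps_nth f 0 = 0 \<and> fps_nth f 1 = l \<and> (\<forall>n\<ge>2. abs_val (fps_nth f n) \<le> 1)}"

text \<open>
  \<open>H\<close> is the formal solution of the Schroeder equation \<open>H \<circ> f = \<lambda> H\<close> with \<open>\<lambda> = f'(0)\<close>,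
  normalized by \<open>H(0) = 0\<close> and \<open>H'(0) = 1\<close>. It is unique if \<open>\<lambda>\<close> is neither zero nor a
  root of unity.
\<close>

definition is_conjugacy :: "'a::nonarch_complete_field fps \<Rightarrow> 'a fps \<Rightarrow> bool" where
  "is_conjugacy f H \<longleftrightarrow>
     fps_nth H 0 = 0 \<and> fps_nth H 1 = 1 \<and>
     fps_compose H f = fps_const (fps_nth f 1) * H"

definition is_disk :: "'a::nonarch_complete_field set \<Rightarrow> bool" where
  "is_disk D \<longleftrightarrow> (\<exists>r>0. D = ball 0 r \<or> D = cball 0 r)"

text \<open>
  On the disk \<open>D\<close>, the map \<open>f\<close> is conjugate to \<open>x \<mapsto> \<lambda> x\<close> by the analytic map given by \<open>H\<close>,
  whose inverse \<open>H(D) \<rightarrow> D\<close> is analytic too, being given by \<open>G\<close>.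
\<close>

definition linearizes_on :: "'a::nonarch_complete_field fps \<Rightarrow> 'a set \<Rightarrow> bool" where
  "linearizes_on f D \<longleftrightarrow>
     is_disk D \<and> fps_converges_on f D \<and> fps_value f ` D \<subseteq> D \<and>
     (\<exists>H G. is_conjugacy f H \<and>
        fps_converges_on H D \<and> fps_converges_on G (fps_value H ` D) \<and>
        (\<forall>x\<in>D. fps_value G (fps_value H x) = x) \<and>
        (\<forall>x\<in>D. fps_value H (fps_value f x) = fps_nth f 1 * fps_value H x))"

definition is_linearization_disk :: "'a::nonarch_complete_field fps \<Rightarrow> 'a set \<Rightarrow> bool" where
  "is_linearization_disk f D \<longleftrightarrow>
     linearizes_on f D \<and> (\<forall>D'. linearizes_on f D' \<longrightarrow> D' \<subseteq> D)"

definition linearization_disk :: "'a::nonarch_complete_field fps \<Rightarrow> 'a set" where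
  "linearization_disk f = (THE D. is_linearization_disk f D)"

lemma linearization_disk_eqI:
  "is_linearization_disk f D \<Longrightarrow> linearization_disk f = D"
  unfolding linearization_disk_def is_linearization_disk_def
  by (rule the_equality) (auto intro!: subset_antisym)

text \<open>
  In \<open>\<complex>\<^sub>p\<close> the absolute values are dense in the positive reals, so a disk determines its radius.
\<close>

definition linearization_radius :: "'a::nonarch_complete_field fps \<Rightarrow> real" where
  "linearization_radius f =
     (THE r. r > 0 \<and> (linearization_disk f = ball 0 r \<or> linearization_disk f = cball 0 r))"

definition quadratic_series :: "'a::nonarch_complete_field \<Rightarrow> 'a fps" where
  "quadratic_series l = fps_const l * fps_X + fps_X ^ 2"

text \<open>
  For \<open>j \<ge> 1\<close> this is the distance from \<open>1\<close> to a primitive \<open>p\<^sup>j\<close>-th root of unity.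
\<close>

definition root_dist :: "nat \<Rightarrow> nat \<Rightarrow> real" where
  "root_dist p j =
     (if j = 0 then 0 else real p powr (- 1 / (real p ^ (j - 1) * (real p - 1))))"

definition root_level :: "nat \<Rightarrow> real \<Rightarrow> nat" where
  "root_level p d = (THE s. root_dist p s \<le> d \<and> d < root_dist p (s + 1))"

definition p_power_roots_of_unity :: "nat \<Rightarrow> 'a::nonarch_complete_field set" where
  "p_power_roots_of_unity p = {g. \<exists>k. g ^ (p ^ k) = 1}"

text \<open>
  The integers \<open>s\<close> and \<open>t\<close> exist and are unique because \<open>root_dist p\<close> strictly increases from
  \<open>0\<close> to the limit \<open>1\<close>. The result does not depend on the choice of the minimizer \<open>g\<close>.
\<close>

definition r_tilde :: "nat \<Rightarrow> 'a::nonarch_complete_field \<Rightarrow> real" where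
  "r_tilde p l =
     (let m = (LEAST n. n \<ge> 1 \<and> abs_val (1 - l ^ n) < 1);
          s = root_level p (abs_val (1 - l ^ m));
          g = (ARG_MIN (\<lambda>g. abs_val (g - l ^ m)) g. g \<in> p_power_roots_of_unity p);
          t = root_level p (abs_val (g - l ^ m))
      in root_dist p (s + 1) powr (1 / real m)
         * real p powr (- (real s - real t) / (real m * real p ^ s))
         * abs_val (1 - l ^ m) powr (real s * (real p - 1) / (real m * real p))
         * abs_val (g - l ^ m) powr (1 / (real m * real p powr (real s - real t))))"

end

theory Submission
  imports Defs
begin

text \<open>
  Let \<open>H = x + \<Sum> b\<^sub>k x\<^sup>k\<close> be the conjugacy of \<open>f\<close>. Comparing coefficients in
  \<open>H \<circ> f = l H\<close> gives a recursion in which \<open>b\<^bsub>n+1\<^esub> (l - l\<^bsup>n+1\<^esup>)\<close> is a sum over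
  the earlier coefficients \<open>b\<^bsub>j\<^esub>\<close>, weighted by the coefficients of \<open>x\<^bsup>n+1\<^esup>\<close> in
  \<open>f\<^sup>j\<close>. In this sum exactly one term is largest. For \<open>n\<close> prime to \<open>p\<close> it is the term with
  \<open>b\<^sub>n\<close>, whose weight \<open>n l\<^bsup>n-1\<^esup> a\<^sub>2\<close> is a unit. For \<open>n\<close> divisible by \<open>p\<close> this weight is at
  most \<open>1/p < |1 - l|\<close>, and the term with \<open>b\<^bsub>n-1\<^esub>\<close> wins, because its weight is congruent to the
  unit \<open>a\<^sub>2\<^sup>2 - a\<^sub>3\<close>. Therefore \<open>|b\<^bsub>n+1\<^esub>|\<close> is exactly
  \<open>|1 - l|\<^bsup>n div p\<^esup> / \<Prod>\<^bsub>j\<le>n\<^esub> |1 - l\<^sup>j|\<close> (\<open>abs_val_conjugacy_coeff\<close>). These absolute values are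
  the same for all \<open>f\<close> in question, among them the quadratic polynomial, for which
  \<open>a\<^sub>2\<^sup>2 - a\<^sub>3 = 1\<close>.

  It remains to find the decay of the products of small divisors. The factors with \<open>p\<close> not
  dividing \<open>j\<close> all equal \<open>|1 - l|\<close>, and the others form the product for \<open>l\<^sup>p\<close>. Iterating this,
  one arrives at a power of \<open>l\<close> closer to 1 than \<open>R(1)\<close>, where each further \<open>p\<close>-th power divides
  the distance to 1 by \<open>p\<close>. This yields a number \<open>r\<close> with \<open>|b\<^sub>k| r\<^bsup>k-1\<^esup> \<le> 1\<close> for all \<open>k\<close>, while
  \<open>|b\<^sub>k| r\<^bsup>k-1\<^esup> = R(1)\<close> for \<open>k = p\<^sup>N + 1\<close> with \<open>N\<close> large (\<open>small_divisor_product_gain\<close>). By the first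
  property, \<open>H\<close> converges on the open disk of radius \<open>r\<close> and is inverted there by a power series
  (\<open>linearizes_on_ball\<close>). By the second one, \<open>H\<close> diverges at every point of absolute value at
  least \<open>r\<close> (\<open>linearization_disk_maximal\<close>).

  Finally, \<open>|1 - l\<^bsup>p^s\<^esup>|\<close> is expressed by the distance of \<open>l\<close> to the nearest root of unity,
  through the factorization of \<open>X\<^bsup>p^t\<^esup> - 1\<close>, which turns the rate of decay into \<open>r_tilde\<close>
  (\<open>r_tilde_eq_small_divisor_rate\<close>).
\<close>

section \<open>Non-archimedean absolute values\<close>

lemma abs_val_conv_dist: "abs_val x = dist x (0::'a::nonarch_complete_field)"
  by (simp add: dist_abs_val)

lemma abs_val_nonneg [simp]: "0 \<le> abs_val (x::'a::nonarch_complete_field)"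
  by (simp add: abs_val_conv_dist)

lemma abs_val_eq_0_iff [simp]: "abs_val (x::'a::nonarch_complete_field) = 0 \<longleftrightarrow> x = 0"
  by (simp add: abs_val_conv_dist)

lemma abs_val_0 [simp]: "abs_val (0::'a::nonarch_complete_field) = 0"
  by simp

lemma abs_val_pos_iff [simp]: "0 < abs_val (x::'a::nonarch_complete_field) \<longleftrightarrow> x \<noteq> 0"
  by (simp add: abs_val_conv_dist)

lemma abs_val_1 [simp]: "abs_val (1::'a::nonarch_complete_field) = 1"
  using abs_val_mult[of "1::'a" 1] abs_val_eq_0_iff[of "1::'a"] by simp

lemma abs_val_minus [simp]: "abs_val (- x) = abs_val (x::'a::nonarch_complete_field)"
  using dist_abs_val[of 0 x] dist_abs_val[of x 0] by (simp add: dist_commute)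

lemma abs_val_minus_commute: "abs_val (x - y) = abs_val (y - (x::'a::nonarch_complete_field))"
  using abs_val_minus[of "x - y"] by simp

lemma abs_val_diff_le_max: "abs_val (x - y) \<le> max (abs_val x) (abs_val (y::'a::nonarch_complete_field))"
  using abs_val_add_le_max[of x "- y"] by simp

lemma abs_val_power: "abs_val (x ^ n) = abs_val (x::'a::nonarch_complete_field) ^ n"
  by (induction n) (simp_all add: abs_val_mult)

lemma abs_val_inverse: "abs_val (inverse x) = inverse (abs_val (x::'a::nonarch_complete_field))"
proof (cases "x = 0")
  case False
  then have "abs_val x * abs_val (inverse x) = 1"
    by (simp flip: abs_val_mult)
  then show ?thesis
    by (metis inverse_unique)
qed simp

lemma abs_val_prod: "abs_val (\<Prod>i\<in>A. g i) = (\<Prod>i\<in>A. abs_val (g i::'a::nonarch_complete_field))"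
  by (induction A rule: infinite_finite_induct) (simp_all add: abs_val_mult)

lemma abs_val_sum_le:
  fixes g :: "'b \<Rightarrow> 'a::nonarch_complete_field"
  assumes "\<And>i. i \<in> A \<Longrightarrow> abs_val (g i) \<le> M" and "0 \<le> M"
  shows "abs_val (\<Sum>i\<in>A. g i) \<le> M"
  using assms(1)
proof (induction A rule: infinite_finite_induct)
  case (insert i A)
  then show ?case
    using abs_val_add_le_max[of "g i" "sum g A"] by fastforce
qed (use \<open>0 \<le> M\<close> in auto)

lemma abs_val_sum_less:
  fixes g :: "'b \<Rightarrow> 'a::nonarch_complete_field"
  assumes "\<And>i. i \<in> A \<Longrightarrow> abs_val (g i) < M" and "0 < M"
  shows "abs_val (\<Sum>i\<in>A. g i) < M"
  using assms(1)
proof (induction A rule: infinite_finite_induct)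
  case (insert i A)
  then show ?case
    using abs_val_add_le_max[of "g i" "sum g A"] by fastforce
qed (use \<open>0 < M\<close> in auto)

lemma abs_val_of_nat_le_1: "abs_val (of_nat n :: 'a::nonarch_complete_field) \<le> 1"
proof -
  have "abs_val (\<Sum>i<n. 1::'a) \<le> 1"
    by (rule abs_val_sum_le) simp_all
  then show ?thesis
    by simp
qed

lemma abs_val_add_eq_left:
  fixes x y :: "'a::nonarch_complete_field"
  assumes "abs_val y < abs_val x"
  shows "abs_val (x + y) = abs_val x"
  using abs_val_add_le_max[of x y] abs_val_diff_le_max[of "x + y" y] assms by simp

lemma abs_val_eq_1_of_near_1:
  fixes x :: "'a::nonarch_complete_field"
  assumes "abs_val (1 - x) < 1"
  shows "abs_val x = 1"
  using abs_val_add_eq_left[of "x - 1" 1] assms by (simp add: abs_val_minus_commute)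

section \<open>Convergent series\<close>

instance nonarch_complete_field \<subseteq> topological_ab_group_add
proof
  fix a b :: 'a
  show "LIM x (nhds a \<times>\<^sub>F nhds b). fst x + snd x :> nhds (a + b)"
  proof (rule metric_tendsto_imp_tendsto)
    have "((\<lambda>x. dist (fst x) a + dist (snd x) b) \<longlongrightarrow> dist a a + dist b b) (nhds a \<times>\<^sub>F nhds b)"
      by (intro tendsto_add tendsto_dist tendsto_const filterlim_fst filterlim_snd)
    then show "((\<lambda>x. dist (fst x) a + dist (snd x) b) \<longlongrightarrow> 0) (nhds a \<times>\<^sub>F nhds b)"
      by simp
    have "dist (u + v) (a + b) \<le> dist (dist u a + dist v b) 0" for u v :: 'a
      using abs_val_add_le_max[of "u - a" "v - b"] abs_val_nonneg[of "u - a"] abs_val_nonneg[of "v - b"]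
      unfolding dist_abs_val add_diff_add dist_real_def by linarith
    then show "\<forall>\<^sub>F x in nhds a \<times>\<^sub>F nhds b. dist (fst x + snd x) (a + b) \<le> dist (dist (fst x) a + dist (snd x) b) 0"
      by simp
  qed
  show "(uminus \<longlongrightarrow> - a) (nhds a)"
  proof (rule metric_tendsto_imp_tendsto)
    have "((\<lambda>x. dist x a) \<longlongrightarrow> dist a a) (nhds a)"
      by (intro tendsto_dist tendsto_const) (rule filterlim_ident)
    then show "((\<lambda>x. dist x a) \<longlongrightarrow> 0) (nhds a)"
      by simp
    have "dist (- u) (- a) \<le> dist (dist u a) 0" for u
      by (simp add: dist_abs_val abs_val_minus_commute)
    then show "\<forall>\<^sub>F x in nhds a. dist (- x) (- a) \<le> dist (dist x a) 0"
      by simp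
  qed
qed

lemma tendsto_zero_iff_abs_val:
  fixes g :: "'b \<Rightarrow> 'a::nonarch_complete_field"
  shows "(g \<longlongrightarrow> 0) F \<longleftrightarrow> ((\<lambda>x. abs_val (g x)) \<longlongrightarrow> 0) F"
  unfolding tendsto_dist_iff[of g] by (simp add: dist_abs_val)

lemma sums_iff_remainder:
  fixes g :: "nat \<Rightarrow> 'a::nonarch_complete_field"
  shows "g sums s \<longleftrightarrow> (\<lambda>n. abs_val (s - (\<Sum>i<n. g i))) \<longlonglongrightarrow> 0"
  unfolding sums_def tendsto_dist_iff[of _ s] by (simp add: dist_abs_val abs_val_minus_commute)

lemma summable_iff_terms_tendsto_0:
  fixes g :: "nat \<Rightarrow> 'a::nonarch_complete_field"
  shows "summable g \<longleftrightarrow> (\<lambda>n. abs_val (g n)) \<longlonglongrightarrow> 0"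
proof
  assume "summable g"
  then obtain s where s: "(\<lambda>n. \<Sum>i<n. g i) \<longlonglongrightarrow> s"
    by (auto simp: summable_def sums_def)
  have "(\<lambda>n. (\<Sum>i<Suc n. g i) - (\<Sum>i<n. g i)) \<longlonglongrightarrow> s - s"
    by (intro tendsto_diff s LIMSEQ_Suc[OF s])
  then show "(\<lambda>n. abs_val (g n)) \<longlonglongrightarrow> 0"
    by (simp add: tendsto_zero_iff_abs_val)
next
  assume lim: "(\<lambda>n. abs_val (g n)) \<longlonglongrightarrow> 0"
  have "Cauchy (\<lambda>n. \<Sum>i<n. g i)"
  proof (rule metric_CauchyI)
    fix e :: real
    assume "0 < e"
    with lim obtain N where N: "\<And>n. n \<ge> N \<Longrightarrow> abs_val (g n) < e"
      by (auto simp: LIMSEQ_def)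
    have less: "abs_val ((\<Sum>i<n. g i) - (\<Sum>i<m. g i)) < e" if "N \<le> m" "m \<le> n" for m n
    proof -
      have "(\<Sum>i<n. g i) - (\<Sum>i<m. g i) = (\<Sum>i\<in>{..<n} - {..<m}. g i)"
        using that by (subst sum_diff) auto
      then show ?thesis
        using N that \<open>0 < e\<close> by (auto intro!: abs_val_sum_less)
    qed
    show "\<exists>M. \<forall>m\<ge>M. \<forall>n\<ge>M. dist (\<Sum>i<m. g i) (\<Sum>i<n. g i) < e"
      by (metis less nle_le dist_abs_val dist_commute)
  qed
  then show "summable g"
    by (simp add: summable_iff_convergent Cauchy_convergent)
qed

lemma abs_val_suminf_le:
  fixes g :: "nat \<Rightarrow> 'a::nonarch_complete_field"
  assumes "g sums s" and "\<And>n. abs_val (g n) \<le> M"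
  shows "abs_val s \<le> M"
proof -
  have "(\<lambda>n. dist (\<Sum>i<n. g i) 0) \<longlonglongrightarrow> dist s 0"
    using assms(1) by (intro tendsto_dist tendsto_const) (simp add: sums_def)
  then have "dist s 0 \<le> M"
  proof (rule LIMSEQ_le_const2, intro exI allI impI)
    show "dist (\<Sum>i<n. g i) 0 \<le> M" for n
      using abs_val_sum_le[of "{..<n}" g M] assms(2) order_trans[OF abs_val_nonneg assms(2)]
      by (simp add: dist_abs_val)
  qed
  then show ?thesis
    by (simp add: dist_abs_val)
qed

lemma sums_const_mult:
  fixes g :: "nat \<Rightarrow> 'a::nonarch_complete_field"
  assumes "g sums s"
  shows "(\<lambda>n. c * g n) sums (c * s)"
proof -
  have "(\<lambda>n. abs_val c * abs_val (s - (\<Sum>i<n. g i))) \<longlonglongrightarrow> abs_val c * 0"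
    using assms by (intro tendsto_mult tendsto_const) (simp add: sums_iff_remainder)
  then show ?thesis
    by (simp add: sums_iff_remainder flip: abs_val_mult sum_distrib_left right_diff_distrib)
qed

lemma tendsto_zero_imp_bounded:
  fixes u :: "nat \<Rightarrow> real"
  assumes "u \<longlonglongrightarrow> 0"
  obtains M where "0 < M" "\<And>n. u n \<le> M"
proof -
  have "Bseq u"
    using assms by (intro convergent_imp_Bseq) (auto simp: convergent_def)
  then obtain M where "0 < M" "\<And>n. norm (u n) \<le> M"
    by (auto simp: Bseq_def)
  then show ?thesis
    using that by (metis abs_le_D1 real_norm_def)
qed

text \<open>
  The square of partial sums differs from the triangle of partial sums by products with a large
  index in one factor; by the ultrametric inequality their sum is as small as each of them.
\<close>

lemma cauchy_product_sums:
  fixes a b :: "nat \<Rightarrow> 'a::nonarch_complete_field"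
  assumes a: "summable a" and b: "summable b"
  shows "(\<lambda>k. \<Sum>i\<le>k. a i * b (k - i)) sums (suminf a * suminf b)"
proof -
  let ?A = "\<lambda>n. \<Sum>i<n. a i" and ?B = "\<lambda>n. \<Sum>i<n. b i"
  have a0: "(\<lambda>n. abs_val (a n)) \<longlonglongrightarrow> 0" and b0: "(\<lambda>n. abs_val (b n)) \<longlonglongrightarrow> 0"
    using a b by (simp_all add: summable_iff_terms_tendsto_0)
  obtain M where M: "0 < M" "\<And>n. abs_val (a n) \<le> M"
    using tendsto_zero_imp_bounded[OF a0] by blast
  obtain M' where M': "0 < M'" "\<And>n. abs_val (b n) \<le> M'"
    using tendsto_zero_imp_bounded[OF b0] by blast
  have "(\<lambda>n. ?A n * ?B n) \<longlonglongrightarrow> suminf a * suminf b"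
  proof -
    have sa: "abs_val (?A n) \<le> M" for n
      using M by (intro abs_val_sum_le) (auto simp: less_imp_le)
    have ra: "(\<lambda>n. abs_val (suminf a - ?A n)) \<longlonglongrightarrow> 0"
      using a by (simp add: summable_sums flip: sums_iff_remainder)
    have rb: "(\<lambda>n. abs_val (suminf b - ?B n)) \<longlonglongrightarrow> 0"
      using b by (simp add: summable_sums flip: sums_iff_remainder)
    have le: "dist (?A n * ?B n) (suminf a * suminf b)
        \<le> abs_val (suminf a - ?A n) * abs_val (suminf b) + M * abs_val (suminf b - ?B n)" (is "_ \<le> ?e n") for n
    proof -
      have "dist (?A n * ?B n) (suminf a * suminf b)
          = abs_val ((suminf a - ?A n) * suminf b + ?A n * (suminf b - ?B n))"
        by (subst dist_commute) (simp add: dist_abs_val algebra_simps)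
      also have "\<dots> \<le> abs_val (suminf a - ?A n) * abs_val (suminf b)
          + abs_val (?A n) * abs_val (suminf b - ?B n)"
        by (rule order_trans[OF abs_val_add_le_max]) (simp add: abs_val_mult)
      also have "\<dots> \<le> ?e n"
        by (intro add_left_mono mult_right_mono sa) simp
      finally show ?thesis .
    qed
    have lim: "?e \<longlonglongrightarrow> 0"
      by (intro tendsto_add_zero tendsto_mult_left_zero tendsto_mult_right_zero ra rb)
    have "(\<lambda>n. dist (?A n * ?B n) (suminf a * suminf b)) \<longlonglongrightarrow> 0"
      by (rule tendsto_sandwich[OF _ _ tendsto_const lim]) (simp_all add: le)
    then show ?thesis
      by (simp add: tendsto_dist_iff[of "\<lambda>n. ?A n * ?B n"])
  qed
  moreover have "(\<lambda>n. ?A n * ?B n - (\<Sum>k<n. \<Sum>i\<le>k. a i * b (k - i))) \<longlonglongrightarrow> 0"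
    unfolding tendsto_zero_iff_abs_val
  proof (rule LIMSEQ_I)
    fix e :: real
    assume "0 < e"
    obtain Ka where Ka: "\<And>n. n \<ge> Ka \<Longrightarrow> abs_val (a n) < e / M'"
      using LIMSEQ_D[OF a0, of "e / M'"] \<open>0 < e\<close> M' by auto
    obtain Kb where Kb: "\<And>n. n \<ge> Kb \<Longrightarrow> abs_val (b n) < e / M"
      using LIMSEQ_D[OF b0, of "e / M"] \<open>0 < e\<close> M by auto
    have "abs_val (?A n * ?B n - (\<Sum>k<n. \<Sum>i\<le>k. a i * b (k - i))) < e" if "n \<ge> Ka + Kb" for n
    proof -
      let ?T = "{(i, j). i + j < n}"
      have T: "?T \<subseteq> {..<n} \<times> {..<n}"
        by auto
      have "?A n * ?B n - (\<Sum>k<n. \<Sum>i\<le>k. a i * b (k - i))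
          = (\<Sum>(i, j)\<in>{..<n} \<times> {..<n} - ?T. a i * b j)"
        by (subst sum_diff[OF _ T])
          (simp_all add: sum_product sum.cartesian_product sum.triangle_reindex)
      also have "abs_val \<dots> < e"
      proof (rule abs_val_sum_less[OF _ \<open>0 < e\<close>])
        fix z
        assume "z \<in> {..<n} \<times> {..<n} - ?T"
        then obtain i j where z: "z = (i, j)" and ij: "\<not> i + j < n"
          by auto
        with that consider "i \<ge> Ka" | "j \<ge> Kb"
          by linarith
        then have "abs_val (a i * b j) < e"
        proof cases
          case 1
          have "abs_val (a i) * abs_val (b j) \<le> abs_val (a i) * M'"
            using M' by (simp add: mult_left_mono)
          also have "\<dots> < e"
            using Ka[OF 1] M' by (simp add: field_simps)
          finally show ?thesis
            by (simp add: abs_val_mult)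
        next
          case 2
          have "abs_val (a i) * abs_val (b j) \<le> M * abs_val (b j)"
            using M by (simp add: mult_right_mono)
          also have "\<dots> < e"
            using Kb[OF 2] M by (simp add: field_simps)
          finally show ?thesis
            by (simp add: abs_val_mult)
        qed
        then show "abs_val (case z of (i, j) \<Rightarrow> a i * b j) < e"
          by (simp add: z)
      qed
      finally show ?thesis .
    qed
    then show "\<exists>N. \<forall>n\<ge>N. norm (abs_val (?A n * ?B n - (\<Sum>k<n. \<Sum>i\<le>k. a i * b (k - i))) - 0) < e"
      by auto
  qed
  ultimately show ?thesis
    unfolding sums_def using tendsto_diff by fastforce
qed

section \<open>Evaluation of power series\<close>

lemma fps_value_sums:
  assumes "fps_converges_on F D" and "x \<in> D"
  shows "(\<lambda>n. fps_nth F n * x ^ n) sums fps_value F x"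
  using assms by (auto simp: fps_converges_on_def fps_value_def)

lemma fps_converges_on_singleton_iff:
  "fps_converges_on F {x} \<longleftrightarrow> (\<lambda>n. abs_val (fps_nth F n) * abs_val x ^ n) \<longlonglongrightarrow> 0"
  by (simp add: fps_converges_on_def summable_iff_terms_tendsto_0 abs_val_mult abs_val_power)

lemma fps_value_mult:
  assumes "fps_converges_on F {x}" "fps_converges_on G {x}"
  shows "fps_converges_on (F * G) {x} \<and> fps_value (F * G) x = fps_value F x * fps_value G x"
proof -
  have "(\<lambda>k. \<Sum>i\<le>k. (fps_nth F i * x ^ i) * (fps_nth G (k - i) * x ^ (k - i)))
      sums (fps_value F x * fps_value G x)"
    using assms unfolding fps_value_def fps_converges_on_def by (intro cauchy_product_sums) auto
  moreover have "(\<Sum>i\<le>k. (fps_nth F i * x ^ i) * (fps_nth G (k - i) * x ^ (k - i)))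
      = fps_nth (F * G) k * x ^ k" for k
    unfolding fps_mult_nth sum_distrib_right atLeast0AtMost
    by (intro sum.cong refl) (auto simp: mult_ac simp flip: power_add)
  ultimately have "(\<lambda>k. fps_nth (F * G) k * x ^ k) sums (fps_value F x * fps_value G x)"
    by simp
  then show ?thesis
    by (auto simp: fps_converges_on_def fps_value_def sums_iff)
qed

lemma fps_value_const:
  "fps_converges_on (fps_const c) {x} \<and> fps_value (fps_const c) x = c"
proof -
  have "(\<lambda>n. fps_nth (fps_const c) n * x ^ n) sums (\<Sum>n\<in>{0}. fps_nth (fps_const c) n * x ^ n)"
    by (intro sums_finite) auto
  then show ?thesis
    by (auto simp: fps_converges_on_def fps_value_def sums_iff)
qed

lemma fps_value_X: "fps_converges_on fps_X {x} \<and> fps_value fps_X x = x"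
proof -
  have "(\<lambda>n. fps_nth fps_X n * x ^ n) sums (\<Sum>n\<in>{1}. fps_nth fps_X n * x ^ n)"
    by (intro sums_finite) auto
  then show ?thesis
    by (auto simp: fps_converges_on_def fps_value_def sums_iff)
qed

lemma fps_value_power:
  assumes "fps_converges_on F {x}"
  shows "fps_converges_on (F ^ n) {x} \<and> fps_value (F ^ n) x = fps_value F x ^ n"
proof (induction n)
  case 0
  then show ?case
    using fps_value_const[of 1 x] by simp
next
  case (Suc n)
  then show ?case
    using fps_value_mult[OF assms, of "F ^ n"] by simp
qed

text \<open>
  A bound for the Gauss norm at radius \<open>\<rho>\<close>. It makes sense without convergence and for radii that are
  not absolute values.
\<close>

definition gauss_bounded :: "real \<Rightarrow> 'a::nonarch_complete_field fps \<Rightarrow> real \<Rightarrow> bool" where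
  "gauss_bounded \<rho> F M \<longleftrightarrow> (\<forall>n. abs_val (fps_nth F n) * \<rho> ^ n \<le> M)"

lemma gauss_bounded_nonneg: "gauss_bounded \<rho> F M \<Longrightarrow> 0 \<le> M"
  unfolding gauss_bounded_def
  by (drule spec[of _ 0]) (simp add: order_trans[OF abs_val_nonneg[of "fps_nth F 0"]])

lemma gauss_bounded_mult:
  assumes "0 \<le> \<rho>" "gauss_bounded \<rho> F M" "gauss_bounded \<rho> G M'"
  shows "gauss_bounded \<rho> (F * G) (M * M')"
  unfolding gauss_bounded_def
proof
  fix n
  have nonneg: "0 \<le> M" "0 \<le> M'"
    using assms by (auto intro: gauss_bounded_nonneg)
  show "abs_val (fps_nth (F * G) n) * \<rho> ^ n \<le> M * M'"
  proof (cases "\<rho> ^ n = 0")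
    case True
    show ?thesis
      using nonneg by (simp only: True) simp
  next
    case False
    then have pos: "0 < \<rho> ^ n"
      using zero_le_power[OF \<open>0 \<le> \<rho>\<close>, of n] by linarith
    have "abs_val (fps_nth F i * fps_nth G (n - i)) \<le> M * M' / \<rho> ^ n" if "i \<le> n" for i
    proof -
      have "(abs_val (fps_nth F i) * \<rho> ^ i) * (abs_val (fps_nth G (n - i)) * \<rho> ^ (n - i)) \<le> M * M'"
        using assms nonneg by (intro mult_mono) (auto simp: gauss_bounded_def)
      moreover have "\<rho> ^ i * \<rho> ^ (n - i) = \<rho> ^ n"
        using that by (simp flip: power_add)
      moreover have "(abs_val (fps_nth F i) * \<rho> ^ i) * (abs_val (fps_nth G (n - i)) * \<rho> ^ (n - i))
          = (abs_val (fps_nth F i) * abs_val (fps_nth G (n - i))) * (\<rho> ^ i * \<rho> ^ (n - i))"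
        by (simp add: mult_ac)
      ultimately have "abs_val (fps_nth F i * fps_nth G (n - i)) * \<rho> ^ n \<le> M * M'"
        by (simp only: abs_val_mult)
      then show ?thesis
        using pos by (simp add: pos_le_divide_eq)
    qed
    then have "abs_val (fps_nth (F * G) n) \<le> M * M' / \<rho> ^ n"
      unfolding fps_mult_nth using nonneg pos by (intro abs_val_sum_le) auto
    then show ?thesis
      using pos by (simp add: field_simps)
  qed
qed

lemma gauss_bounded_power:
  assumes "0 \<le> \<rho>" "gauss_bounded \<rho> F M"
  shows "gauss_bounded \<rho> (F ^ k) (M ^ k)"
proof (induction k)
  case 0
  show ?case
    by (auto simp: gauss_bounded_def)
next
  case (Suc k)
  then show ?case
    using gauss_bounded_mult[OF assms] by simp
qed

lemma abs_val_fps_value_le: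
  assumes F: "gauss_bounded (abs_val x) F M" and conv: "fps_converges_on F {x}"
  shows "abs_val (fps_value F x) \<le> M"
proof (rule abs_val_suminf_le)
  show "(\<lambda>n. fps_nth F n * x ^ n) sums fps_value F x"
    using conv by (rule fps_value_sums) simp
  show "abs_val (fps_nth F n * x ^ n) \<le> M" for n
    using F by (simp add: gauss_bounded_def abs_val_mult abs_val_power)
qed

text \<open>
  Cutting \<open>A\<close> off at degree \<open>K\<close> makes the composition a finite sum, for which evaluation is
  multiplicative. The error is a series whose terms at \<open>x\<close> are all bounded by the supremum of
  \<open>|A\<^sub>k| M\<^sup>k\<close> over \<open>k \<ge> K\<close>.
\<close>

lemma fps_value_compose:
  fixes A B :: "'a::nonarch_complete_field fps"
  assumes B0: "fps_nth B 0 = 0"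
    and conv: "fps_converges_on B {x}" "fps_converges_on (fps_compose A B) {x}"
    and M: "gauss_bounded (abs_val x) B M"
    and A: "(\<lambda>k. abs_val (fps_nth A k) * M ^ k) \<longlonglongrightarrow> 0"
  shows "fps_value (fps_compose A B) x = fps_value A (fps_value B x)"
proof -
  define y where "y = fps_value B x"
  define V where "V = fps_value (fps_compose A B) x"
  have M_nonneg: "0 \<le> M"
    using M by (rule gauss_bounded_nonneg)
  have small: "abs_val (V - (\<Sum>k<K. fps_nth A k * y ^ k)) \<le> e"
    if e: "0 < e" and K: "\<And>k. k \<ge> K \<Longrightarrow> abs_val (fps_nth A k) * M ^ k \<le> e" for K e
  proof -
    have "(\<lambda>n. fps_nth (B ^ k) n * x ^ n) sums (y ^ k)" for k
      using fps_value_power[OF conv(1), of k] fps_value_sums[of "B ^ k" "{x}" x] by (simp add: y_def)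
    then have sum_K: "(\<lambda>n. \<Sum>k<K. fps_nth A k * (fps_nth (B ^ k) n * x ^ n)) sums (\<Sum>k<K. fps_nth A k * y ^ k)"
      by (intro sums_sum sums_const_mult)
    have sum_V: "(\<lambda>n. fps_nth (fps_compose A B) n * x ^ n) sums V"
      unfolding V_def by (rule fps_value_sums[OF conv(2)]) simp
    have "(\<lambda>n. fps_nth (fps_compose A B) n * x ^ n
        + - (\<Sum>k<K. fps_nth A k * (fps_nth (B ^ k) n * x ^ n))) sums (V + - (\<Sum>k<K. fps_nth A k * y ^ k))"
      using sums_add[OF sum_V sums_const_mult[OF sum_K, of "- 1"]] by simp
    moreover have "abs_val (fps_nth (fps_compose A B) n * x ^ n
        + - (\<Sum>k<K. fps_nth A k * (fps_nth (B ^ k) n * x ^ n))) \<le> e" for n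
    proof -
      let ?t = "\<lambda>k. fps_nth A k * (fps_nth (B ^ k) n * x ^ n)"
      have "fps_nth (fps_compose A B) n * x ^ n = (\<Sum>k\<in>{0..n}. ?t k)"
        by (simp add: fps_compose_nth sum_distrib_right mult.assoc)
      also have "\<dots> = (\<Sum>k\<in>{..<K + Suc n}. ?t k)"
        using startsby_zero_power_prefix[OF B0] by (intro sum.mono_neutral_left) auto
      finally have "fps_nth (fps_compose A B) n * x ^ n + - (\<Sum>k<K. ?t k)
          = (\<Sum>k\<in>{..<K + Suc n} - {..<K}. ?t k)"
        by (subst sum_diff) auto
      also have "abs_val \<dots> \<le> e"
      proof (rule abs_val_sum_le)
        fix k
        assume "k \<in> {..<K + Suc n} - {..<K}"
        then have "abs_val (fps_nth A k) * M ^ k \<le> e"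
          using K by auto
        moreover have "abs_val (fps_nth (B ^ k) n) * abs_val x ^ n \<le> M ^ k"
          using gauss_bounded_power[OF _ M] by (auto simp: gauss_bounded_def)
        ultimately have "abs_val (fps_nth A k) * (abs_val (fps_nth (B ^ k) n) * abs_val x ^ n) \<le> e"
          by (meson abs_val_nonneg mult_left_mono order_trans)
        then show "abs_val (?t k) \<le> e"
          by (simp add: abs_val_mult abs_val_power)
      qed (use e in simp)
      finally show ?thesis .
    qed
    ultimately show ?thesis
      using abs_val_suminf_le[of _ "V + - (\<Sum>k<K. fps_nth A k * y ^ k)" e] by simp
  qed
  have "(\<lambda>k. fps_nth A k * y ^ k) sums V"
    unfolding sums_iff_remainder
  proof (rule LIMSEQ_I)
    fix e :: real
    assume "0 < e"
    then obtain K where K: "\<And>k. k \<ge> K \<Longrightarrow> abs_val (fps_nth A k) * M ^ k < e / 2"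
      using LIMSEQ_D[OF A, of "e / 2"] by (auto simp: M_nonneg)
    have "abs_val (V - (\<Sum>k<n. fps_nth A k * y ^ k)) < e" if "n \<ge> K" for n
    proof -
      have "abs_val (V - (\<Sum>k<n. fps_nth A k * y ^ k)) \<le> e / 2"
      proof (rule small)
        show "abs_val (fps_nth A k) * M ^ k \<le> e / 2" if "n \<le> k" for k
          using K[of k] that \<open>n \<ge> K\<close> by linarith
      qed (use \<open>0 < e\<close> in simp)
      then show ?thesis
        using \<open>0 < e\<close> by linarith
    qed
    then show "\<exists>N. \<forall>n\<ge>N. norm (abs_val (V - (\<Sum>k<n. fps_nth A k * y ^ k)) - 0) < e"
      by auto
  qed
  then show ?thesis
    by (simp add: y_def V_def fps_value_def sums_iff)
qed

section \<open>Distances of powers from 1\<close>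

locale padic_valued_field =
  fixes p :: nat and T :: "'a::nonarch_complete_field itself"
  assumes prime_p: "prime p" and abs_val_p: "abs_val (of_nat p :: 'a) = 1 / real p"
begin

lemma p_gt_1: "1 < p"
  using prime_p by (rule prime_gt_1_nat)

lemma abs_val_of_nat_dvd:
  assumes "p dvd n"
  shows "abs_val (of_nat n :: 'a) \<le> 1 / real p"
proof -
  obtain m where "n = p * m"
    using assms by blast
  then have "abs_val (of_nat n :: 'a) = 1 / real p * abs_val (of_nat m :: 'a)"
    by (simp add: abs_val_mult abs_val_p)
  also have "\<dots> \<le> 1 / real p * 1"
    by (intro mult_left_mono abs_val_of_nat_le_1) simp
  finally show ?thesis
    by simp
qed

lemma abs_val_of_nat_not_dvd:
  assumes "\<not> p dvd n"
  shows "abs_val (of_nat n :: 'a) = 1"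
proof -
  have "n \<noteq> 0"
    using assms by (intro notI) simp
  moreover have "coprime n p"
    using prime_imp_coprime[OF prime_p assms] by (simp add: coprime_commute)
  ultimately obtain u v where uv: "n * u = p * v + 1"
    using bezout_nat[of n p] by (auto simp: coprime_iff_gcd_eq_1)
  have "abs_val (of_nat (p * v) :: 'a) < 1"
    using abs_val_of_nat_dvd[of "p * v"] p_gt_1 by (auto intro: le_less_trans)
  then have "abs_val (1 + of_nat (p * v) :: 'a) = abs_val (1 :: 'a)"
    by (intro abs_val_add_eq_left) simp
  moreover have "(1 + of_nat (p * v) :: 'a) = of_nat n * of_nat u"
    unfolding of_nat_mult[symmetric] uv by simp
  ultimately have "abs_val (of_nat n :: 'a) * abs_val (of_nat u :: 'a) = 1"
    by (simp add: abs_val_mult)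
  moreover have "abs_val (of_nat n :: 'a) * abs_val (of_nat u :: 'a) \<le> abs_val (of_nat n :: 'a) * 1"
    by (intro mult_left_mono abs_val_of_nat_le_1) simp
  ultimately show ?thesis
    using abs_val_of_nat_le_1[of n, where 'a = 'a] by simp
qed

lemma dist_1_power_le:
  fixes x :: 'a
  assumes "abs_val x = 1"
  shows "abs_val (1 - x ^ n) \<le> abs_val (1 - x)"
proof -
  have "abs_val (1 - x ^ n) = abs_val (1 - x) * abs_val (\<Sum>i<n. x ^ i)"
    by (simp add: one_diff_power_eq abs_val_mult)
  also have "\<dots> \<le> abs_val (1 - x) * 1"
    using assms by (intro mult_left_mono abs_val_sum_le) (simp_all add: abs_val_power)
  finally show ?thesis
    by simp
qed

text \<open>
  The cofactor \<open>1 + x + \<dots> + x\<^bsup>u-1\<^esup>\<close> is congruent to \<open>u\<close> modulo \<open>1 - x\<close>.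
\<close>

lemma dist_1_power_coprime:
  fixes x :: 'a
  assumes x: "abs_val (1 - x) < 1" and u: "\<not> p dvd u"
  shows "abs_val (1 - x ^ u) = abs_val (1 - x)"
proof -
  have x1: "abs_val x = 1"
    using x by (rule abs_val_eq_1_of_near_1)
  have "abs_val (\<Sum>i<u. x ^ i - 1) < 1"
  proof (rule abs_val_sum_less)
    show "abs_val (x ^ i - 1) < 1" for i
      using dist_1_power_le[OF x1, of i] x by (simp add: abs_val_minus_commute)
  qed simp
  then have "abs_val (of_nat u + (\<Sum>i<u. x ^ i - 1)) = 1"
    using abs_val_of_nat_not_dvd[OF u] abs_val_add_eq_left[of "\<Sum>i<u. x ^ i - 1" "of_nat u"] by simp
  moreover have "of_nat u + (\<Sum>i<u. x ^ i - 1) = (\<Sum>i<u. x ^ i)"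
    by (simp add: sum_subtractf)
  ultimately show ?thesis
    by (simp add: one_diff_power_eq abs_val_mult)
qed

text \<open>
  In the binomial expansion of \<open>(1 + h)\<^sup>p - 1\<close> the terms \<open>p h\<close> and \<open>h\<^sup>p\<close> dominate, because all
  binomial coefficients in between are divisible by \<open>p\<close>.
\<close>

lemma pth_power_expansion:
  fixes x :: 'a
  assumes x: "abs_val (1 - x) < 1" "x \<noteq> 1"
  obtains u v where "1 - x ^ p = u + v" "abs_val u = abs_val (1 - x) / p" "abs_val v = abs_val (1 - x) ^ p"
proof -
  define h where "h = x - 1"
  have h: "0 < abs_val h" "abs_val h < 1" "abs_val (1 - x) = abs_val h"
    using x by (simp_all add: h_def abs_val_minus_commute)
  let ?g = "\<lambda>k. of_nat (p choose k) * h ^ k"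
  obtain q where q: "p = Suc (Suc q)"
    using p_gt_1 by (cases p; cases "p - 1") auto
  have "x ^ p = (h + 1) ^ p"
    by (simp add: h_def)
  also have "\<dots> = (\<Sum>k\<le>p. ?g k)"
    by (simp add: binomial_ring)
  also have "\<dots> = 1 + (of_nat p * h + (\<Sum>k\<in>{2..<p}. ?g k)) + h ^ p"
  proof -
    have "{..p} = insert 0 (insert 1 (insert p {2..<p}))"
      using q by auto
    then show ?thesis
      using q by (simp add: algebra_simps)
  qed
  finally have "1 - x ^ p = - (of_nat p * h + (\<Sum>k\<in>{2..<p}. ?g k)) + - (h ^ p)"
    by simp
  moreover have "abs_val (of_nat p * h + (\<Sum>k\<in>{2..<p}. ?g k)) = abs_val (of_nat p * h)"
  proof (rule abs_val_add_eq_left, rule abs_val_sum_less)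
    fix k
    assume k: "k \<in> {2..<p}"
    then have "abs_val (of_nat (p choose k) :: 'a) \<le> 1 / p"
      using prime_p by (intro abs_val_of_nat_dvd dvd_choose_prime) auto
    then have "abs_val (?g k) \<le> 1 / p * abs_val h ^ k"
      by (simp add: abs_val_mult abs_val_power mult_right_mono del: times_divide_eq_left)
    also have "\<dots> < 1 / p * abs_val h"
      using h k p_gt_1 power_strict_decreasing[of 1 k "abs_val h"] by (intro mult_strict_left_mono) auto
    finally show "abs_val (?g k) < abs_val (of_nat p * h)"
      by (simp add: abs_val_mult abs_val_p)
  qed (use h p_gt_1 in \<open>auto simp: abs_val_mult abs_val_p\<close>)
  ultimately show ?thesis
    using h by (intro that[of "- (of_nat p * h + (\<Sum>k\<in>{2..<p}. ?g k))" "- (h ^ p)"])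
      (simp_all only: abs_val_minus, simp_all add: abs_val_mult abs_val_p abs_val_power)
qed

lemma dist_1_pth_power_le:
  fixes x :: 'a
  assumes "abs_val (1 - x) < 1"
  shows "abs_val (1 - x ^ p) \<le> max (abs_val (1 - x) / p) (abs_val (1 - x) ^ p)"
proof (cases "x = 1")
  case False
  with assms obtain u v where "1 - x ^ p = u + v" "abs_val u = abs_val (1 - x) / p"
      "abs_val v = abs_val (1 - x) ^ p"
    by (rule pth_power_expansion)
  then show ?thesis
    using abs_val_add_le_max[of u v] by simp
qed simp

lemma dist_1_pth_power_less:
  fixes x :: 'a
  assumes "abs_val (1 - x) < 1" "x \<noteq> 1"
  shows "abs_val (1 - x ^ p) < abs_val (1 - x)"
proof -
  have "abs_val (1 - x) / p < abs_val (1 - x)"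
    using assms p_gt_1 by (simp add: field_simps)
  moreover have "abs_val (1 - x) ^ p < abs_val (1 - x)"
    using assms p_gt_1 power_strict_decreasing[of 1 p "abs_val (1 - x)"] by simp
  ultimately show ?thesis
    using dist_1_pth_power_le[OF assms(1)] by linarith
qed

text \<open>Comparing with \<open>R(1) = p\<^bsup>-1/(p-1)\<^esup>\<close> decides which of \<open>p h\<close> and \<open>h\<^sup>p\<close> is larger.\<close>

lemma root_dist_pos: "j \<noteq> 0 \<Longrightarrow> 0 < root_dist p j"
  using p_gt_1 by (simp add: root_dist_def)

lemma root_dist_less_1: "root_dist p j < 1"
  using p_gt_1 by (auto simp: root_dist_def powr_minus_divide powr_neg_one intro!: powr_less_one)

lemma root_dist_1_power: "root_dist p 1 ^ p = root_dist p 1 / p"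
proof -
  have "root_dist p 1 ^ p = p powr (- (1 / (real p - 1)) * p)"
    using p_gt_1 by (simp add: root_dist_def powr_power)
  also have "- (1 / (real p - 1)) * p = - (1 / (real p - 1)) - 1"
    using p_gt_1 by (simp add: field_simps)
  also have "p powr \<dots> = root_dist p 1 / p"
    using p_gt_1 by (simp add: root_dist_def powr_diff)
  finally show ?thesis .
qed

lemma root_dist_Suc_power: "root_dist p (Suc (Suc j)) ^ p = root_dist p (Suc j)"
  using p_gt_1 by (simp add: root_dist_def powr_power)

lemma root_dist_strict_mono: "i < j \<Longrightarrow> root_dist p i < root_dist p j"
proof (induction rule: less_Suc_induct)
  case (1 j)
  show ?case
  proof (cases j)
    case (Suc i)
    show ?thesis
      unfolding Suc using root_dist_Suc_power[of i] root_dist_less_1[of "Suc (Suc i)"]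
        root_dist_pos[of "Suc (Suc i)"] p_gt_1 power_strict_decreasing[of 1 p "root_dist p (Suc (Suc i))"]
      by simp
  qed (use p_gt_1 in \<open>simp add: root_dist_def\<close>)
qed simp

lemma root_dist_mono: "i \<le> j \<Longrightarrow> root_dist p i \<le> root_dist p j"
  using root_dist_strict_mono by (metis le_less)

lemma root_dist_unbounded:
  assumes "d < 1"
  shows "\<exists>s. d < root_dist p (Suc s)"
proof -
  have "(\<lambda>s. inverse (real p) ^ s) \<longlonglongrightarrow> 0"
    using p_gt_1 by (intro LIMSEQ_power_zero) (simp add: inverse_less_1_iff)
  then have "(\<lambda>s. - (inverse (real p) ^ s * (1 / (real p - 1)))) \<longlonglongrightarrow> - (0 * (1 / (real p - 1)))"
    by (intro tendsto_minus tendsto_mult tendsto_const)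
  then have "(\<lambda>s. real p powr (- (inverse (real p) ^ s * (1 / (real p - 1))))) \<longlonglongrightarrow> real p powr (- (0 * (1 / (real p - 1))))"
    using p_gt_1 by (intro tendsto_powr tendsto_const) auto
  then have "(\<lambda>s. root_dist p (Suc s)) \<longlonglongrightarrow> 1"
    using p_gt_1 by (simp add: root_dist_def power_inverse divide_inverse)
  then have "eventually (\<lambda>s. d < root_dist p (Suc s)) sequentially"
    using assms by (rule order_tendstoD)
  then show ?thesis
    by (auto simp: eventually_sequentially)
qed

lemma root_level:
  assumes "0 \<le> d" "d < 1"
  shows "root_dist p (root_level p d) \<le> d \<and> d < root_dist p (Suc (root_level p d))"
proof -
  define s where "s = (LEAST s. d < root_dist p (Suc s))"
  have s: "d < root_dist p (Suc s)"
    unfolding s_def using root_dist_unbounded[OF assms(2)] by (rule LeastI_ex)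
  have le: "root_dist p s \<le> d"
  proof (cases s)
    case (Suc i)
    have "\<not> d < root_dist p (Suc i)"
      using not_less_Least[of i "\<lambda>s. d < root_dist p (Suc s)"] Suc by (simp add: s_def)
    then show ?thesis
      by (simp add: Suc)
  qed (use assms in \<open>simp add: root_dist_def\<close>)
  have unique: "i = s" if "root_dist p i \<le> d" "d < root_dist p (Suc i)" for i
  proof (rule antisym)
    show "i \<le> s"
      using root_dist_mono[of "Suc s" i] that s by (meson not_less_eq_eq le_less_trans less_irrefl order_trans)
    show "s \<le> i"
      using root_dist_mono[of "Suc i" s] that le
      by (meson not_less_eq_eq le_less_trans less_irrefl order_trans)
  qed
  have "root_level p d = s"
    unfolding root_level_def Suc_eq_plus1[symmetric]
    by (rule the_equality) (use s le unique in blast)+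
  with s le show ?thesis
    by simp
qed

lemma root_dist_power_tower: "root_dist p (Suc s) ^ (p ^ s) = root_dist p 1"
proof (induction s)
  case (Suc s)
  have "root_dist p (Suc (Suc s)) ^ (p ^ Suc s) = (root_dist p (Suc (Suc s)) ^ p) ^ (p ^ s)"
    by (simp only: power_mult power_Suc)
  with Suc show ?case
    by (simp add: root_dist_Suc_power)
qed simp

lemma threshold_iff:
  assumes "0 < d"
  shows "d ^ p < d / p \<longleftrightarrow> d < root_dist p 1" "d / p < d ^ p \<longleftrightarrow> root_dist p 1 < d"
proof -
  let ?R = "root_dist p 1"
  obtain q where q: "p = Suc q" "q > 0"
    using p_gt_1 by (cases p) auto
  have R: "0 < ?R"
    by (simp add: root_dist_pos)
  have power_p: "r ^ p = r * r ^ q" for r :: real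
    by (simp add: q(1))
  have "?R * ?R ^ q = ?R * (1 / p)"
    using root_dist_1_power by (simp only: power_p) simp
  then have Rq: "?R ^ q = 1 / p"
    using R unfolding mult_cancel_left by simp
  have "d ^ p < d / p \<longleftrightarrow> d * d ^ q < d * (1 / p)"
    by (simp add: power_p)
  also have "\<dots> \<longleftrightarrow> d ^ q < 1 / p"
    using \<open>0 < d\<close> by (rule mult_less_cancel_left_pos)
  also have "\<dots> \<longleftrightarrow> d < ?R"
    unfolding Rq[symmetric] not_le[symmetric] using \<open>0 < d\<close> R q(2) by (simp add: power_mono_iff)
  finally show "d ^ p < d / p \<longleftrightarrow> d < ?R" .
  have "d / p < d ^ p \<longleftrightarrow> d * (1 / p) < d * d ^ q"
    by (simp add: power_p)
  also have "\<dots> \<longleftrightarrow> 1 / p < d ^ q"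
    using \<open>0 < d\<close> by (rule mult_less_cancel_left_pos)
  also have "\<dots> \<longleftrightarrow> ?R < d"
    unfolding Rq[symmetric] not_le[symmetric] using \<open>0 < d\<close> R q(2) by (simp add: power_mono_iff)
  finally show "d / p < d ^ p \<longleftrightarrow> ?R < d" .
qed

lemma dist_1_pth_power_small:
  fixes x :: 'a
  assumes "abs_val (1 - x) < root_dist p 1"
  shows "abs_val (1 - x ^ p) = abs_val (1 - x) / p"
proof (cases "x = 1")
  case False
  have "abs_val (1 - x) < 1"
    using assms root_dist_less_1[of 1] by simp
  then obtain u v where uv: "1 - x ^ p = u + v" "abs_val u = abs_val (1 - x) / p"
      "abs_val v = abs_val (1 - x) ^ p"
    using False by (rule pth_power_expansion)
  then have "abs_val v < abs_val u"
    using threshold_iff(1)[of "abs_val (1 - x)"] assms False by simp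
  then show ?thesis
    using abs_val_add_eq_left[of v u] uv by simp
qed simp

lemma dist_1_pth_power_large:
  fixes x :: 'a
  assumes "root_dist p 1 < abs_val (1 - x)" "abs_val (1 - x) < 1"
  shows "abs_val (1 - x ^ p) = abs_val (1 - x) ^ p"
proof -
  have "x \<noteq> 1"
    using assms root_dist_pos[of 1] by auto
  with assms(2) obtain u v where uv: "1 - x ^ p = u + v" "abs_val u = abs_val (1 - x) / p"
      "abs_val v = abs_val (1 - x) ^ p"
    by (rule pth_power_expansion)
  then have "abs_val u < abs_val v"
    using threshold_iff(2)[of "abs_val (1 - x)"] assms \<open>x \<noteq> 1\<close> by simp
  then show ?thesis
    using abs_val_add_eq_left[of u v] uv by (simp add: add.commute)
qed

lemma dist_1_power_tower_small:
  fixes x :: 'a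
  assumes "abs_val (1 - x) < root_dist p 1"
  shows "abs_val (1 - x ^ (p ^ i)) = abs_val (1 - x) / p ^ i"
proof (induction i)
  case (Suc i)
  have "abs_val (1 - x) / p ^ i \<le> abs_val (1 - x)"
    using divide_left_mono[of 1 "real p ^ i" "abs_val (1 - x)"] p_gt_1 by simp
  then have "abs_val (1 - (x ^ p ^ i) ^ p) = abs_val (1 - x ^ (p ^ i)) / p"
    using Suc assms by (intro dist_1_pth_power_small) simp
  with Suc show ?case
    by (simp add: power_mult[symmetric] mult.commute)
qed simp

lemma dist_1_power_tower_le:
  fixes x :: 'a
  assumes x: "root_dist p s \<le> abs_val (1 - x)" "abs_val (1 - x) < 1" and "i \<le> s"
  shows "abs_val (1 - x ^ (p ^ i)) \<le> abs_val (1 - x) ^ (p ^ i)"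
  using \<open>i \<le> s\<close>
proof (induction i)
  case (Suc i)
  let ?d = "abs_val (1 - x)" and ?y = "x ^ (p ^ i)"
  have IH: "abs_val (1 - ?y) \<le> ?d ^ (p ^ i)"
    using Suc by simp
  have "root_dist p 1 = root_dist p (Suc i) ^ (p ^ i)"
    by (simp only: root_dist_power_tower)
  also have "\<dots> \<le> ?d ^ (p ^ i)"
    using Suc.prems x(1) root_dist_mono[of "Suc i" s] root_dist_pos[of "Suc i"]
    by (intro power_mono) auto
  finally have "root_dist p 1 \<le> ?d ^ (p ^ i)" .
  moreover from this have "0 < ?d ^ (p ^ i)"
    using root_dist_pos[of 1] by linarith
  ultimately have "?d ^ (p ^ i) / p \<le> (?d ^ (p ^ i)) ^ p"
    using threshold_iff(1)[of "?d ^ (p ^ i)"] by simp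
  moreover have "abs_val (1 - ?y) / p \<le> ?d ^ (p ^ i) / p"
    using IH by (simp add: divide_right_mono)
  moreover have "abs_val (1 - ?y) ^ p \<le> (?d ^ (p ^ i)) ^ p"
    using IH by (intro power_mono) auto
  moreover have "abs_val (1 - ?y) < 1"
    using x(2) dist_1_power_le[OF abs_val_eq_1_of_near_1[OF x(2)]] by (rule le_less_trans[rotated])
  then have "abs_val (1 - ?y ^ p) \<le> max (abs_val (1 - ?y) / p) (abs_val (1 - ?y) ^ p)"
    by (rule dist_1_pth_power_le)
  ultimately have "abs_val (1 - ?y ^ p) \<le> (?d ^ (p ^ i)) ^ p"
    by linarith
  then show ?case
    by (simp add: power_mult[symmetric] mult.commute)
qed simp

lemma dist_1_power_tower_eq:
  fixes x :: 'a
  assumes x: "root_dist p s \<le> abs_val (1 - x)" "abs_val (1 - x) < 1" and "i < s"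
  shows "abs_val (1 - x ^ (p ^ i)) = abs_val (1 - x) ^ (p ^ i)"
  using \<open>i < s\<close>
proof (induction i)
  case (Suc i)
  let ?d = "abs_val (1 - x)" and ?y = "x ^ (p ^ i)"
  have IH: "abs_val (1 - ?y) = ?d ^ (p ^ i)"
    using Suc by simp
  have "root_dist p 1 = root_dist p (Suc i) ^ (p ^ i)"
    by (simp only: root_dist_power_tower)
  also have "\<dots> < ?d ^ (p ^ i)"
    using Suc.prems x(1) root_dist_strict_mono[of "Suc i" s] root_dist_pos[of "Suc i"] p_gt_1
    by (intro power_strict_mono) auto
  finally have "abs_val (1 - ?y ^ p) = abs_val (1 - ?y) ^ p"
    using x(2) dist_1_power_le[OF abs_val_eq_1_of_near_1[OF x(2)], of "p ^ i"] IH
    by (intro dist_1_pth_power_large) auto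
  then show ?case
    by (simp add: IH power_mult[symmetric] mult.commute)
qed simp

lemma dist_1_power_tower_below_threshold:
  fixes x :: 'a
  assumes "root_dist p s \<le> abs_val (1 - x)" "abs_val (1 - x) < root_dist p (Suc s)"
  shows "abs_val (1 - x ^ (p ^ s)) < root_dist p 1"
proof -
  have "abs_val (1 - x ^ (p ^ s)) \<le> abs_val (1 - x) ^ (p ^ s)"
    using assms root_dist_less_1[of "Suc s"] by (intro dist_1_power_tower_le) auto
  also have "\<dots> < root_dist p (Suc s) ^ (p ^ s)"
    using assms p_gt_1 by (intro power_strict_mono) auto
  finally show ?thesis
    by (simp only: root_dist_power_tower)
qed

end

section \<open>Products of small divisors\<close>

definition small_divisor_product :: "'a::nonarch_complete_field \<Rightarrow> nat \<Rightarrow> real" where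
  "small_divisor_product x n = (\<Prod>j=1..n. abs_val (1 - x ^ j))"

lemma small_divisor_product_0 [simp]: "small_divisor_product x 0 = 1"
  by (simp add: small_divisor_product_def)

lemma small_divisor_product_Suc:
  "small_divisor_product x (Suc n) = small_divisor_product x n * abs_val (1 - x ^ Suc n)"
  by (simp add: small_divisor_product_def)

lemma small_divisor_product_pos:
  assumes "\<forall>n\<ge>1. x ^ n \<noteq> 1"
  shows "0 < small_divisor_product x n"
  unfolding small_divisor_product_def
proof (rule prod_pos)
  show "0 < abs_val (1 - x ^ j)" if "j \<in> {1..n}" for j
    using assms[rule_format, of j] that by auto
qed

text \<open>
  The exponential rate at which \<open>small_divisor_product x n\<close> decays with \<open>n\<close>. The parameter \<open>s\<close>
  is a number of \<open>p\<close>-th powers after which \<open>x\<close> is closer to 1 than \<open>R(1)\<close>; from there on the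
  product is \<open>|1 - x|\<^sup>n |n!|\<close>, and \<open>|n!|\<close> decays like \<open>R(1)\<^sup>n\<close>.
\<close>

primrec small_divisor_rate :: "nat \<Rightarrow> nat \<Rightarrow> 'a::nonarch_complete_field \<Rightarrow> real" where
  "small_divisor_rate p 0 x = abs_val (1 - x) * root_dist p 1"
| "small_divisor_rate p (Suc s) x =
     abs_val (1 - x) * (small_divisor_rate p s (x ^ p) / abs_val (1 - x)) powr (1 / p)"

context padic_valued_field
begin

lemma small_divisor_product_split:
  fixes x :: 'a
  assumes "abs_val (1 - x) < 1"
  shows "small_divisor_product x n = abs_val (1 - x) ^ (n - n div p) * small_divisor_product (x ^ p) (n div p)"
proof (induction n)
  case (Suc n)
  show ?case
  proof (cases "p dvd Suc n")
    case True
    then obtain k where k: "Suc n = p * k"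
      by blast
    with p_gt_1 obtain i where i: "k = Suc i"
      by (cases k) auto
    have "n div p = i"
      using k p_gt_1 unfolding i by (intro div_nat_eqI) auto
    moreover have "Suc n div p = Suc i"
      using k p_gt_1 i by simp
    moreover have "x ^ Suc n = (x ^ p) ^ Suc i"
      by (simp only: k i power_mult)
    moreover have "Suc n - Suc i = n - i"
      by simp
    ultimately show ?thesis
      by (simp only: small_divisor_product_Suc Suc mult.assoc)
  next
    case False
    then have "Suc n div p = n div p"
      by (simp add: div_Suc dvd_eq_mod_eq_0)
    moreover have "Suc n - n div p = Suc (n - n div p)"
      by (simp add: Suc_diff_le)
    ultimately show ?thesis
      using dist_1_power_coprime[OF assms False]
      by (simp only: small_divisor_product_Suc Suc power_Suc mult_ac)
  qed
qed simp

lemma powr_root_power: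
  assumes "0 < c"
  shows "(c powr (1 / real p)) ^ n = c powr (n / p)"
  using assms by (simp add: powr_power)

text \<open>
  Only every \<open>p\<close>-th divisor involves \<open>x\<^sup>p\<close>. The rounding in \<open>n div p\<close> is harmless for a base at
  most 1. The parameter \<open>b\<close> allows a gain of one factor \<open>b\<close> for every such divisor.
\<close>

lemma small_divisor_product_lower_step:
  fixes x :: 'a
  assumes x: "abs_val (1 - x) < 1" "x \<noteq> 1" and b: "0 < b" and r: "0 < r" "r \<le> abs_val (1 - x) * b"
    and le: "r ^ (n div p) \<le> small_divisor_product (x ^ p) (n div p)"
  shows "(abs_val (1 - x) * (r / (abs_val (1 - x) * b)) powr (1 / p)) ^ n * b ^ (n div p)
      \<le> small_divisor_product x n"
proof -
  let ?d = "abs_val (1 - x)" and ?q = "n div p"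
  let ?c = "r / (?d * b)"
  have d: "0 < ?d"
    using x by auto
  have c: "0 < ?c" "?c \<le> 1"
    using r b d by (simp_all add: divide_le_eq)
  have "real ?q \<le> n / p"
    by (rule of_nat_div_le_of_nat)
  then have "?c powr (n / p) \<le> ?c powr ?q"
    using c by (intro powr_mono') auto
  also have "\<dots> = ?c ^ ?q"
    using c by (intro powr_realpow)
  finally have "(?d * ?c powr (1 / p)) ^ n * b ^ ?q \<le> ?d ^ n * ?c ^ ?q * b ^ ?q"
    unfolding power_mult_distrib powr_root_power[OF c(1)]
    using d b by (intro mult_right_mono mult_left_mono) auto
  also have "\<dots> = ?d ^ (n - ?q) * r ^ ?q"
    using d b by (simp add: power_divide power_mult_distrib power_diff)
  also have "\<dots> \<le> ?d ^ (n - ?q) * small_divisor_product (x ^ p) ?q"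
    by (intro mult_left_mono le) simp
  also have "\<dots> = small_divisor_product x n"
    using x(1) by (rule small_divisor_product_split[symmetric])
  finally show ?thesis .
qed

text \<open>At multiples of \<open>p\<close> nothing is lost by rounding.\<close>

lemma small_divisor_product_exact_step:
  fixes x :: 'a
  assumes x: "abs_val (1 - x) < 1" "x \<noteq> 1" and b: "0 < b" and r: "0 < r"
    and eq: "r ^ k = small_divisor_product (x ^ p) k * R"
  shows "(abs_val (1 - x) * (r / (abs_val (1 - x) * b)) powr (1 / p)) ^ (p * k) * b ^ k
      = small_divisor_product x (p * k) * R"
proof -
  let ?d = "abs_val (1 - x)"
  let ?c = "r / (?d * b)"
  have d: "0 < ?d"
    using x by auto
  have c: "0 < ?c"
    using r b d by simp
  have k: "p * k div p = k" "real (p * k) / p = real k" "k \<le> p * k"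
    using p_gt_1 by simp_all
  have "(?d * ?c powr (1 / p)) ^ (p * k) * b ^ k = ?d ^ (p * k) * ?c ^ k * b ^ k"
    unfolding power_mult_distrib powr_root_power[OF c] k(2) powr_realpow[OF c] ..
  also have "\<dots> = ?d ^ (p * k - k) * r ^ k"
    using d b k(3) by (simp add: power_divide power_mult_distrib power_diff)
  also have "\<dots> = small_divisor_product x (p * k) * R"
    unfolding small_divisor_product_split[OF x(1), of "p * k"] k(1) eq by (simp only: mult.assoc)
  finally show ?thesis .
qed

lemma small_divisor_rate_pos:
  fixes x :: 'a
  assumes "\<forall>n\<ge>1. x ^ n \<noteq> 1"
  shows "0 < small_divisor_rate p s x"
  using assms
proof (induction s arbitrary: x)
  case 0
  from 0[rule_format, of 1] show ?case
    by (auto simp: root_dist_pos)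
next
  case (Suc s)
  have "\<forall>n\<ge>1. (x ^ p) ^ n \<noteq> 1"
    using Suc.prems p_gt_1 unfolding power_mult[symmetric] by simp
  with Suc have "0 < small_divisor_rate p s (x ^ p)"
    by blast
  with Suc.prems[rule_format, of 1] show ?case
    by auto
qed

lemma small_divisor_rate_0_unfold:
  fixes x :: 'a
  assumes "abs_val (1 - x) < root_dist p 1" "x \<noteq> 1"
  shows "small_divisor_rate p (Suc 0) x = small_divisor_rate p 0 x"
proof -
  have "(root_dist p 1 / p) powr (1 / p) = root_dist p 1"
    unfolding root_dist_1_power[symmetric]
    using root_dist_pos[of 1] p_gt_1 by (simp add: powr_powr flip: powr_realpow)
  then show ?thesis
    using assms dist_1_pth_power_small[OF assms(1)] by simp
qed

text \<open>The rate does not change if more \<open>p\<close>-th powers are taken than necessary.\<close>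

lemma small_divisor_rate_Suc:
  fixes x :: 'a
  assumes "abs_val (1 - x ^ (p ^ s)) < root_dist p 1" "\<forall>n\<ge>1. x ^ n \<noteq> 1"
  shows "small_divisor_rate p (Suc s) x = small_divisor_rate p s x"
  using assms
proof (induction s arbitrary: x)
  case 0
  from 0(2)[rule_format, of 1] 0(1) show ?case
    by (intro small_divisor_rate_0_unfold) simp_all
next
  case (Suc s)
  have "small_divisor_rate p (Suc s) (x ^ p) = small_divisor_rate p s (x ^ p)"
  proof (rule Suc.IH)
    show "abs_val (1 - (x ^ p) ^ (p ^ s)) < root_dist p 1"
      using Suc.prems(1) by (simp only: power_mult power_Suc)
    show "\<forall>n\<ge>1. (x ^ p) ^ n \<noteq> 1"
      using Suc.prems(2) p_gt_1 unfolding power_mult[symmetric] by simp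
  qed
  then show ?case
    by simp
qed

lemma small_divisor_product_lower_small:
  fixes x :: 'a
  assumes "abs_val (1 - x) < root_dist p 1" "\<forall>n\<ge>1. x ^ n \<noteq> 1"
  shows "small_divisor_rate p 0 x ^ n \<le> small_divisor_product x n"
  using assms
proof (induction n arbitrary: x rule: less_induct)
  case (less n)
  have x: "abs_val (1 - x) < 1" "x \<noteq> 1"
    using less.prems(1) less.prems(2)[rule_format, of 1] root_dist_less_1[of 1] by auto
  show ?case
  proof (cases "n = 0")
    case False
    have y: "abs_val (1 - x ^ p) < root_dist p 1" "\<forall>n\<ge>1. (x ^ p) ^ n \<noteq> 1"
      using less.prems(1) dist_1_pth_power_less[OF x] less.prems(2) p_gt_1
      unfolding power_mult[symmetric] by simp_all
    have "small_divisor_rate p 0 (x ^ p) \<le> abs_val (1 - x ^ p) * 1"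
      unfolding small_divisor_rate.simps using root_dist_less_1[of 1] by (intro mult_left_mono) auto
    then have le: "small_divisor_rate p 0 (x ^ p) \<le> abs_val (1 - x) * 1"
      using dist_1_pth_power_less[OF x] by simp
    have "small_divisor_rate p 0 (x ^ p) ^ (n div p) \<le> small_divisor_product (x ^ p) (n div p)"
      using False p_gt_1 y by (intro less.IH) auto
    from small_divisor_product_lower_step[OF x _ small_divisor_rate_pos[OF y(2)] le this]
    show ?thesis
      using small_divisor_rate_0_unfold[OF less.prems(1) x(2)] x(2) by simp
  qed simp
qed

lemma small_divisor_product_lower:
  fixes x :: 'a
  assumes "abs_val (1 - x) < 1" "abs_val (1 - x ^ (p ^ s)) < root_dist p 1" "\<forall>n\<ge>1. x ^ n \<noteq> 1"
  shows "small_divisor_rate p s x ^ n \<le> small_divisor_product x n"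
  using assms
proof (induction s arbitrary: x n)
  case 0
  then show ?case
    by (intro small_divisor_product_lower_small) auto
next
  case (Suc s)
  have x: "abs_val (1 - x) < 1" "x \<noteq> 1"
    using Suc.prems(1) Suc.prems(3)[rule_format, of 1] by auto
  have lower: "small_divisor_rate p s (x ^ p) ^ n \<le> small_divisor_product (x ^ p) n" for n
  proof (rule Suc.IH)
    show "abs_val (1 - x ^ p) < 1"
      using dist_1_pth_power_less[OF x] x(1) by simp
    show "abs_val (1 - (x ^ p) ^ (p ^ s)) < root_dist p 1"
      using Suc.prems(2) by (simp only: power_mult power_Suc)
    show y: "\<forall>n\<ge>1. (x ^ p) ^ n \<noteq> 1"
      using Suc.prems(3) p_gt_1 unfolding power_mult[symmetric] by simp
  qed
  have "0 < small_divisor_rate p s (x ^ p)"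
    using Suc.prems(3) p_gt_1 by (intro small_divisor_rate_pos) (simp flip: power_mult)
  moreover have "small_divisor_rate p s (x ^ p) \<le> abs_val (1 - x) * 1"
    using lower[of 1] dist_1_pth_power_less[OF x] by (simp add: small_divisor_product_def)
  ultimately show ?case
    using small_divisor_product_lower_step[OF x, of 1 "small_divisor_rate p s (x ^ p)" n] lower by simp
qed

lemma small_divisor_product_exact_small:
  fixes x :: 'a
  assumes "abs_val (1 - x) < root_dist p 1" "\<forall>n\<ge>1. x ^ n \<noteq> 1"
  shows "small_divisor_rate p 0 x ^ (p ^ N) = small_divisor_product x (p ^ N) * root_dist p 1"
  using assms
proof (induction N arbitrary: x)
  case 0
  then show ?case
    by (simp add: small_divisor_product_def)
next
  case (Suc N)
  have x: "abs_val (1 - x) < 1" "x \<noteq> 1"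
    using Suc.prems(1) Suc.prems(2)[rule_format, of 1] root_dist_less_1[of 1] by auto
  have y: "abs_val (1 - x ^ p) < root_dist p 1" "\<forall>n\<ge>1. (x ^ p) ^ n \<noteq> 1"
    using Suc.prems(1) dist_1_pth_power_less[OF x] Suc.prems(2) p_gt_1
    unfolding power_mult[symmetric] by simp_all
  from small_divisor_product_exact_step[OF x _ small_divisor_rate_pos[OF y(2)] Suc.IH[OF y], of 1]
  show ?case
    using small_divisor_rate_0_unfold[OF Suc.prems(1) x(2)] x(2) by simp
qed

lemma small_divisor_product_exact:
  fixes x :: 'a
  assumes "abs_val (1 - x) < 1" "abs_val (1 - x ^ (p ^ s)) < root_dist p 1" "\<forall>n\<ge>1. x ^ n \<noteq> 1"
  shows "small_divisor_rate p s x ^ (p ^ (N + s)) = small_divisor_product x (p ^ (N + s)) * root_dist p 1"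
  using assms
proof (induction s arbitrary: x)
  case 0
  then show ?case
    using small_divisor_product_exact_small by simp
next
  case (Suc s)
  have x: "abs_val (1 - x) < 1" "x \<noteq> 1"
    using Suc.prems(1) Suc.prems(3)[rule_format, of 1] by auto
  have y: "\<forall>n\<ge>1. (x ^ p) ^ n \<noteq> 1"
    using Suc.prems(3) p_gt_1 unfolding power_mult[symmetric] by simp
  have "small_divisor_rate p s (x ^ p) ^ (p ^ (N + s)) = small_divisor_product (x ^ p) (p ^ (N + s)) * root_dist p 1"
  proof (rule Suc.IH[OF _ _ y])
    show "abs_val (1 - x ^ p) < 1"
      using dist_1_pth_power_less[OF x] x(1) by simp
    show "abs_val (1 - (x ^ p) ^ (p ^ s)) < root_dist p 1"
      using Suc.prems(2) by (simp only: power_mult power_Suc)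
  qed
  from small_divisor_product_exact_step[OF x _ small_divisor_rate_pos[OF y] this, of 1]
  show ?case
    by simp
qed

lemma small_divisor_rate_closed_form:
  fixes x :: 'a
  assumes "\<forall>n\<ge>1. x ^ n \<noteq> 1" "\<And>i. i < s \<Longrightarrow> abs_val (1 - x ^ (p ^ i)) = abs_val (1 - x) ^ (p ^ i)"
  shows "small_divisor_rate p s x = abs_val (1 - x) powr (real s * (real p - 1) / p)
      * abs_val (1 - x ^ (p ^ s)) powr (1 / real p ^ s) * root_dist p (Suc s)"
  using assms
proof (induction s arbitrary: x)
  case 0
  from 0(1)[rule_format, of 1] show ?case
    by simp
next
  case (Suc s)
  define d where "d = abs_val (1 - x)"
  define e where "e = abs_val (1 - x ^ (p ^ Suc s))"
  have d: "0 < d"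
    using Suc.prems(1)[rule_format, of 1] by (auto simp: d_def)
  have e: "0 < e"
    using Suc.prems(1)[rule_format, of "p ^ Suc s"] p_gt_1 by (auto simp: e_def)
  have y: "\<forall>n\<ge>1. (x ^ p) ^ n \<noteq> 1"
    using Suc.prems(1) p_gt_1 unfolding power_mult[symmetric] by simp
  have dp: "abs_val (1 - x ^ p) = d ^ p" if "0 < s"
    using Suc.prems(2)[of 1] that by (simp add: d_def)
  have "small_divisor_rate p s (x ^ p) = abs_val (1 - x ^ p) powr (real s * (real p - 1) / p)
      * abs_val (1 - (x ^ p) ^ (p ^ s)) powr (1 / real p ^ s) * root_dist p (Suc s)"
  proof (rule Suc.IH[OF y])
    fix i
    assume "i < s"
    then have "abs_val (1 - x ^ (p ^ Suc i)) = d ^ (p ^ Suc i)"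
      using Suc.prems(2)[of "Suc i"] by (simp add: d_def)
    then show "abs_val (1 - (x ^ p) ^ (p ^ i)) = abs_val (1 - x ^ p) ^ (p ^ i)"
      using dp \<open>i < s\<close> by (simp add: power_mult)
  qed
  moreover have "abs_val (1 - x ^ p) powr (real s * (real p - 1) / p) = d powr (real s * (real p - 1))"
  proof (cases "s = 0")
    case True
    with y[rule_format, of 1] d show ?thesis
      by simp
  next
    case False
    with dp d p_gt_1 show ?thesis
      by (simp add: powr_powr flip: powr_realpow)
  qed
  moreover have "abs_val (1 - (x ^ p) ^ (p ^ s)) = e"
    by (simp only: e_def power_mult power_Suc)
  ultimately have "small_divisor_rate p (Suc s) x
      = d * (d powr (real s * (real p - 1)) * e powr (1 / real p ^ s) * root_dist p (Suc s) / d) powr (1 / p)"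
    by (simp add: d_def)
  also have "\<dots> = d powr (1 + (real s * (real p - 1) - 1) / p) * e powr (1 / real p ^ Suc s) * root_dist p (Suc (Suc s))"
  proof -
    have "root_dist p (Suc s) powr (1 / p) = root_dist p (Suc (Suc s))"
      unfolding root_dist_Suc_power[of s, symmetric]
      using root_dist_pos[of "Suc (Suc s)"] p_gt_1 by (simp add: powr_powr flip: powr_realpow)
    moreover have "d powr (real s * (real p - 1)) * e powr (1 / real p ^ s) * root_dist p (Suc s) / d
        = d powr (real s * (real p - 1) - 1) * e powr (1 / real p ^ s) * root_dist p (Suc s)"
      using d by (simp add: powr_diff)
    ultimately show ?thesis
      using d e root_dist_pos[of "Suc s"]
      by (simp add: powr_mult powr_powr powr_add mult_ac)
  qed
  also have "1 + (real s * (real p - 1) - 1) / p = real (Suc s) * (real p - 1) / p"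
    using p_gt_1 by (simp add: field_simps)
  finally show ?case
    by (simp only: d_def e_def)
qed

text \<open>
  The bounds for the products of small divisors when one factor \<open>|1 - x|\<close> is gained for every
  divisor that is a \<open>p\<close>-th power; this replaces the rate by \<open>|1 - x|\<^bsup>-1/p\<^esup>\<close> times the rate.
\<close>

lemma small_divisor_product_gain:
  fixes x :: 'a and s :: nat
  defines "\<rho> \<equiv> abs_val (1 - x) powr (- 1 / real p) * small_divisor_rate p s x"
  assumes x: "1 / p < abs_val (1 - x)" "abs_val (1 - x) < 1"
    and s: "abs_val (1 - x ^ (p ^ s)) < root_dist p 1"
    and not_root: "\<forall>n\<ge>1. x ^ n \<noteq> 1"
  shows small_divisor_product_gain_lower:
      "\<rho> ^ n * abs_val (1 - x) ^ (n div p) \<le> small_divisor_product x n"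
    and small_divisor_product_gain_exact:
      "\<rho> ^ (p ^ Suc (N + s)) * abs_val (1 - x) ^ (p ^ (N + s))
        = small_divisor_product x (p ^ Suc (N + s)) * root_dist p 1"
proof -
  let ?d = "abs_val (1 - x)"
  define r where "r = small_divisor_rate p s (x ^ p)"
  have "x \<noteq> 1"
    using not_root[rule_format, of 1] by simp
  then have d: "0 < ?d"
    by auto
  have y1: "abs_val (1 - x ^ p) < 1"
    using dist_1_pth_power_less[OF x(2) \<open>x \<noteq> 1\<close>] x(2) by simp
  have y2: "abs_val (1 - (x ^ p) ^ (p ^ s)) < root_dist p 1"
  proof -
    have "abs_val (1 - (x ^ (p ^ s)) ^ p) \<le> abs_val (1 - x ^ (p ^ s))"
      using abs_val_eq_1_of_near_1[OF x(2)] by (intro dist_1_power_le) (simp add: abs_val_power)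
    with s show ?thesis
      by (simp add: power_mult[symmetric] mult.commute)
  qed
  have y3: "\<forall>n\<ge>1. (x ^ p) ^ n \<noteq> 1"
    using not_root p_gt_1 unfolding power_mult[symmetric] by simp
  have r: "0 < r"
    unfolding r_def using y3 by (rule small_divisor_rate_pos)
  have "r ^ 1 \<le> small_divisor_product (x ^ p) 1"
    unfolding r_def by (rule small_divisor_product_lower[OF y1 y2 y3])
  also have "\<dots> \<le> max (?d / p) (?d ^ p)"
    using dist_1_pth_power_le[OF x(2)] by (simp add: small_divisor_product_def)
  \<comment> \<open>The rate for \<open>x\<^sup>p\<close> must stay below 1 after two factors \<open>|1 - x|\<close> are taken out of it,
    which \<open>1/p < |1 - x|\<close> ensures.\<close>
  also have "\<dots> \<le> ?d * ?d"
  proof -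
    have "?d * (1 / p) \<le> ?d * ?d"
      using x(1) d by (intro mult_left_mono) auto
    moreover have "?d ^ p \<le> ?d ^ 2"
      using x(2) d p_gt_1 by (intro power_decreasing) auto
    ultimately show ?thesis
      by (simp add: power2_eq_square)
  qed
  finally have r_le: "r \<le> ?d * ?d"
    by simp
  have "small_divisor_rate p s x = ?d * (r / ?d) powr (1 / p)"
    using small_divisor_rate_Suc[OF s not_root] by (simp add: r_def)
  then have \<rho>: "\<rho> = ?d * (r / (?d * ?d)) powr (1 / p)"
    using d r by (simp add: \<rho>_def powr_divide powr_mult powr_minus field_simps)
  show "\<rho> ^ n * ?d ^ (n div p) \<le> small_divisor_product x n"
    unfolding \<rho> using small_divisor_product_lower[OF y1 y2 y3]
    by (intro small_divisor_product_lower_step x \<open>x \<noteq> 1\<close> d r r_le) (simp add: r_def)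
  show "\<rho> ^ (p ^ Suc (N + s)) * ?d ^ (p ^ (N + s)) = small_divisor_product x (p ^ Suc (N + s)) * root_dist p 1"
    unfolding \<rho> power_Suc using small_divisor_product_exact[OF y1 y2 y3]
    by (intro small_divisor_product_exact_step x \<open>x \<noteq> 1\<close> d r) (simp add: r_def)
qed

end

section \<open>The coefficients of the conjugacy\<close>

lemma conjugacy_coeff_recursion:
  assumes "fps_nth f 0 = 0" "is_conjugacy f H"
  shows "fps_nth H (Suc n) * (fps_nth f 1 - fps_nth f 1 ^ Suc n)
    = (\<Sum>j<n. fps_nth H (Suc j) * fps_nth (f ^ Suc j) (Suc n))"
proof -
  have "fps_nth f 1 * fps_nth H (Suc n) = fps_nth (fps_compose H f) (Suc n)"
    using assms(2) by (simp add: is_conjugacy_def)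
  also have "\<dots> = (\<Sum>j<Suc (Suc n). fps_nth H j * fps_nth (f ^ j) (Suc n))"
    by (simp add: fps_compose_nth atLeast0AtMost lessThan_Suc_atMost)
  also have "\<dots> = (\<Sum>j<n. fps_nth H (Suc j) * fps_nth (f ^ Suc j) (Suc n))
      + fps_nth H (Suc n) * fps_nth f 1 ^ Suc n"
    unfolding sum.lessThan_Suc_shift[of _ "Suc n"] using assms
    by (simp add: is_conjugacy_def startsby_zero_power_nth_same del: power_Suc)
  finally show ?thesis
    by (simp add: algebra_simps)
qed

fun conjugacy_coeff :: "'a::nonarch_complete_field fps \<Rightarrow> nat \<Rightarrow> 'a" where
  "conjugacy_coeff f n =
     (if n \<le> 1 then of_nat n
      else (\<Sum>j<n. conjugacy_coeff f j * fps_nth (f ^ j) n) / (fps_nth f 1 - fps_nth f 1 ^ n))"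

declare conjugacy_coeff.simps [simp del]

lemma conjugacy_exists:
  assumes f0: "fps_nth f 0 = 0" and l0: "fps_nth f 1 \<noteq> 0" and not_root: "\<forall>n\<ge>1. fps_nth f 1 ^ n \<noteq> 1"
  shows "\<exists>H. is_conjugacy f H"
proof
  let ?l = "fps_nth f 1" and ?H = "Abs_fps (conjugacy_coeff f)"
  have "fps_nth (fps_compose ?H f) n = ?l * conjugacy_coeff f n" for n
  proof -
    have "fps_nth (fps_compose ?H f) n = (\<Sum>j<n. conjugacy_coeff f j * fps_nth (f ^ j) n)
        + conjugacy_coeff f n * ?l ^ n"
      using f0 by (simp add: fps_compose_nth atLeast0AtMost startsby_zero_power_nth_same
          flip: lessThan_Suc_atMost)
    moreover have "(\<Sum>j<n. conjugacy_coeff f j * fps_nth (f ^ j) n) = conjugacy_coeff f n * (?l - ?l ^ n)"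
    proof (cases "n \<le> 1")
      case True
      then consider "n = 0" | "n = 1"
        by linarith
      then show ?thesis
        by cases (simp_all add: conjugacy_coeff.simps)
    next
      case False
      then obtain k where "n = Suc k" "1 \<le> k"
        by (cases n) auto
      with not_root l0 have "?l - ?l ^ n \<noteq> 0"
        by simp
      with False show ?thesis
        by (simp add: conjugacy_coeff.simps[of f n])
    qed
    ultimately show ?thesis
      by (simp add: algebra_simps)
  qed
  then show "is_conjugacy f ?H"
    by (simp add: is_conjugacy_def fps_eq_iff conjugacy_coeff.simps)
qed

lemma fps_power_nth_first:
  "fps_nth ((U :: 'a::comm_ring_1 fps) ^ Suc n) 1 = of_nat (Suc n) * fps_nth U 0 ^ n * fps_nth U 1"
proof (induction n)
  case (Suc n)
  have "fps_nth (U ^ Suc (Suc n)) 1 = fps_nth U 0 * fps_nth (U ^ Suc n) 1 + fps_nth U 1 * fps_nth (U ^ Suc n) 0"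
    by (subst power_Suc) (rule fps_mult_nth_1)
  then show ?case
    unfolding Suc fps_power_zeroth by (simp add: algebra_simps)
qed simp

lemma fps_power_nth_second:
  "fps_nth ((U :: 'a::comm_ring_1 fps) ^ Suc (Suc n)) 2
    = of_nat (Suc (Suc n) choose 2) * fps_nth U 0 ^ n * fps_nth U 1 ^ 2
      + of_nat (Suc (Suc n)) * fps_nth U 0 ^ Suc n * fps_nth U 2"
proof -
  have mult_2: "fps_nth (A * B) 2 = fps_nth A 0 * fps_nth B 2 + fps_nth A 1 * fps_nth B 1 + fps_nth A 2 * fps_nth B 0"
    for A B :: "'a fps"
    by (simp add: fps_mult_nth numeral_2_eq_2)
  show ?thesis
  proof (induction n)
    case 0
    show ?case
      by (simp add: power2_eq_square mult_2 algebra_simps) (simp add: numeral_2_eq_2)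
  next
    case (Suc n)
    have "fps_nth (U ^ Suc (Suc (Suc n))) 2 = fps_nth U 0 * fps_nth (U ^ Suc (Suc n)) 2
        + fps_nth U 1 * fps_nth (U ^ Suc (Suc n)) 1 + fps_nth U 2 * fps_nth (U ^ Suc (Suc n)) 0"
      by (subst power_Suc) (rule mult_2)
    moreover have "Suc (Suc (Suc n)) choose 2 = (Suc (Suc n) choose 2) + Suc (Suc n)"
      by (simp add: numeral_2_eq_2)
    ultimately show ?case
      unfolding Suc fps_power_nth_first fps_power_zeroth
      by (simp add: algebra_simps power2_eq_square)
  qed
qed

text \<open>Writing \<open>f = X U\<close> reduces the lowest coefficients of powers of \<open>f\<close> to those of \<open>U\<close>.\<close>

lemma fps_power_nth_add:
  assumes "fps_nth (f :: 'a::comm_ring_1 fps) 0 = 0"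
  shows "fps_nth (f ^ m) (m + i) = fps_nth (fps_shift 1 f ^ m) i"
proof -
  have "f = fps_X * fps_shift 1 f"
    using assms by (simp add: fps_eq_iff)
  then have "f ^ m = fps_X ^ m * fps_shift 1 f ^ m"
    by (metis power_mult_distrib)
  then show ?thesis
    by (simp add: fps_X_power_mult_nth)
qed

lemma indifferent_series_gauss_bounded:
  assumes "f \<in> indifferent_series l" "abs_val l \<le> 1"
  shows "gauss_bounded 1 f 1"
proof -
  have "abs_val (fps_nth f n) \<le> 1" for n
  proof -
    consider "n = 0" | "n = 1" | "n \<ge> 2"
      by linarith
    then show ?thesis
      using assms by cases (auto simp: indifferent_series_def)
  qed
  then show ?thesis
    by (simp add: gauss_bounded_def)
qed

context padic_valued_field
begin

text \<open>
  Modulo the maximal ideal, \<open>l = 1\<close>. If \<open>p\<close> divides \<open>N + 1\<close>, then \<open>N = -1\<close> and the binomial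
  coefficient \<open>N choose 2\<close> is \<open>1\<close> modulo \<open>p\<close>, which leaves \<open>a\<^sub>2\<^sup>2 - a\<^sub>3\<close>.
\<close>

lemma abs_val_second_coeff_power:
  fixes f :: "'a fps"
  assumes p: "3 \<le> p" and l: "abs_val (1 - l) < 1" and f: "f \<in> indifferent_series l"
    and a: "abs_val ((fps_nth f 2)\<^sup>2 - fps_nth f 3) = 1" and dvd: "p dvd i + 3"
  shows "abs_val (fps_nth (f ^ (i + 2)) (i + 4)) = 1"
proof -
  let ?a = "fps_nth f 2" and ?b = "fps_nth f 3" and ?N = "i + 2" and ?c = "(i + 2) choose 2"
  have f0: "fps_nth f 0 = 0" "fps_nth f 1 = l" and ab: "abs_val ?a \<le> 1" "abs_val ?b \<le> 1"
    using f by (simp_all add: indifferent_series_def)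
  have l1: "abs_val l = 1"
    using l by (rule abs_val_eq_1_of_near_1)
  have near: "abs_val (l ^ j - 1) < 1" for j
    using dist_1_power_le[OF l1, of j] l by (simp add: abs_val_minus_commute)
  have near_of_nat: "abs_val (of_nat k * (l ^ j - 1)) < 1" for k j
    using mult_right_mono[OF abs_val_of_nat_le_1[of k, where 'a = 'a] abs_val_nonneg[of "l ^ j - 1"]] near[of j]
    by (simp add: abs_val_mult)
  have small: "abs_val (of_nat (k * (i + 3)) :: 'a) < 1" for k
    using abs_val_of_nat_dvd[of "k * (i + 3)"] dvd p_gt_1 by (auto intro: le_less_trans)
  have binom: "abs_val (of_nat ?c - 1 :: 'a) < 1"
  proof -
    have "2 * ?c = (i + 2) * (i + 1)"
      by (simp add: choose_two)
    then have "2 * ?c = i * (i + 3) + 2"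
      by (simp add: algebra_simps)
    then have "(of_nat (2 * ?c) :: 'a) = of_nat (i * (i + 3) + 2)"
      by (simp only:)
    then have "of_nat 2 * (of_nat ?c - 1 :: 'a) = of_nat (i * (i + 3))"
      by (simp add: algebra_simps)
    then have "abs_val (of_nat 2 :: 'a) * abs_val (of_nat ?c - 1 :: 'a) < 1"
      using small[of i] by (simp only: flip: abs_val_mult)
    moreover have "\<not> p dvd 2"
      using p by (auto dest: dvd_imp_le)
    ultimately show ?thesis
      using abs_val_of_nat_not_dvd[of 2] by simp
  qed
  have "i + 4 = ?N + 2"
    by simp
  then have "fps_nth (f ^ (i + 2)) (i + 4) = fps_nth (f ^ ?N) (?N + 2)"
    by (simp only:)
  also have "\<dots> = fps_nth (fps_shift 1 f ^ ?N) 2"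
    using f0(1) by (rule fps_power_nth_add)
  also have "\<dots> = of_nat ?c * l ^ i * ?a\<^sup>2 + of_nat ?N * l ^ Suc i * ?b"
    using fps_power_nth_second[of "fps_shift 1 f" i] f0 by (simp add: numeral_2_eq_2 numeral_3_eq_3)
  also have "\<dots> = (?a\<^sup>2 - ?b)
      + ((of_nat ?c * (l ^ i - 1) + (of_nat ?c - 1)) * ?a\<^sup>2
        + (of_nat ?N * (l ^ Suc i - 1) + of_nat (1 * (i + 3))) * ?b)"
    by (simp add: algebra_simps)
  also have "abs_val \<dots> = abs_val (?a\<^sup>2 - ?b)"
  proof (rule abs_val_add_eq_left)
    have mult_less: "abs_val (u * v) < 1" if "abs_val u < 1" "abs_val v \<le> 1" for u v :: 'a
      using mult_left_mono[OF that(2) abs_val_nonneg[of u]] that(1) by (simp add: abs_val_mult)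
    have add_less: "abs_val (u + v) < 1" if "abs_val u < 1" "abs_val v < 1" for u v :: 'a
      using abs_val_add_le_max[of u v] that by linarith
    have "abs_val (?a\<^sup>2) \<le> 1"
      using ab by (simp add: abs_val_power power_le_one)
    then show "abs_val ((of_nat ?c * (l ^ i - 1) + (of_nat ?c - 1)) * ?a\<^sup>2
        + (of_nat ?N * (l ^ Suc i - 1) + of_nat (1 * (i + 3))) * ?b) < abs_val (?a\<^sup>2 - ?b)"
      unfolding a by (intro add_less mult_less near_of_nat binom small ab)
  qed
  finally show ?thesis
    using a by simp
qed

text \<open>
  Normally the term with \<open>j = n - 1\<close> dominates the recursion and its coefficient
  \<open>n l\<^bsup>n-1\<^esup> a\<^sub>2\<close> is a unit, so dividing by \<open>|1 - l\<^sup>n|\<close> is all that happens. If \<open>p\<close> divides \<open>n\<close>,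
  that coefficient is divisible by \<open>p\<close>, and since \<open>1/p < |1 - l|\<close> the term falls
  behind the one with \<open>j = n - 2\<close>, whose coefficient is a unit. This replaces one small divisor
  \<open>|1 - l\<^bsup>n-1\<^esup>| = |1 - l|\<close> by 1. As no two terms of the sum compete, the estimate is exact.
\<close>

lemma abs_val_conjugacy_coeff:
  fixes f :: "'a fps"
  assumes p: "3 \<le> p" and l: "1 / p < abs_val (1 - l)" "abs_val (1 - l) < 1"
    and not_root: "\<forall>n\<ge>1. l ^ n \<noteq> 1"
    and f: "f \<in> indifferent_series l"
    and a: "abs_val (fps_nth f 2) = 1" "abs_val ((fps_nth f 2)\<^sup>2 - fps_nth f 3) = 1"
    and H: "is_conjugacy f H"
  shows "abs_val (fps_nth H (Suc n)) = abs_val (1 - l) ^ (n div p) / small_divisor_product l n"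
proof -
  define d where "d = abs_val (1 - l)"
  define B where "B n = d ^ (n div p) / small_divisor_product l n" for n
  have f0: "fps_nth f 0 = 0" "fps_nth f 1 = l"
    using f by (simp_all add: indifferent_series_def)
  have l_neq: "l \<noteq> 1"
    using not_root[rule_format, of 1] by simp
  have l1: "abs_val l = 1"
    using l(2) by (rule abs_val_eq_1_of_near_1)
  have d: "0 < d" "d < 1" "1 / p < d"
    using l l_neq by (auto simp: d_def)
  have B_pos: "0 < B n" for n
    using d small_divisor_product_pos[OF not_root] by (simp add: B_def)
  have B_Suc: "B (Suc n) = B n / d" if "\<not> p dvd Suc n" for n
  proof -
    have "Suc n div p = n div p"
      using that by (simp add: div_Suc dvd_eq_mod_eq_0)
    then show ?thesis
      using dist_1_power_coprime[OF l(2) that]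
      by (simp only: B_def small_divisor_product_Suc) (simp add: d_def)
  qed
  have B_Suc_dvd: "B (Suc n) = B n * d / abs_val (1 - l ^ Suc n)" if "p dvd Suc n" for n
  proof -
    have "Suc n div p = Suc (n div p)"
      using that by (simp add: div_Suc dvd_eq_mod_eq_0)
    then show ?thesis
      by (simp only: B_def small_divisor_product_Suc) (simp add: mult_ac)
  qed
  have B_less_Suc: "B n < B (Suc n)" for n
  proof (cases "p dvd Suc n")
    case True
    then obtain k where k: "Suc n = p * k"
      by blast
    have "abs_val (1 - (l ^ p) ^ k) \<le> abs_val (1 - l ^ p)"
      using l1 by (intro dist_1_power_le) (simp add: abs_val_power)
    also have "\<dots> < d"
      unfolding d_def using l(2) l_neq by (rule dist_1_pth_power_less)
    finally have "abs_val (1 - l ^ Suc n) < d"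
      by (simp only: k power_mult)
    moreover have "0 < abs_val (1 - l ^ Suc n)"
      using not_root[rule_format, of "Suc n"] by simp
    ultimately show ?thesis
      unfolding B_Suc_dvd[OF True] using B_pos[of n] by (simp add: pos_less_divide_eq del: power_Suc)
  next
    case False
    then show ?thesis
      using B_Suc B_pos[of n] d by (simp add: pos_less_divide_eq)
  qed
  have B_less: "B i < B j" if "i < j" for i j
    using that B_less_Suc by (rule lift_Suc_mono_less[rotated])
  have coeff_le: "abs_val (fps_nth (f ^ j) k) \<le> 1" for j k
    using gauss_bounded_power[OF _ indifferent_series_gauss_bounded[OF f], of j] l1
    by (simp add: gauss_bounded_def)
  have "abs_val (fps_nth H (Suc n)) = B n"
  proof (induction n rule: less_induct)
    case (less n)
    let ?t = "\<lambda>j. fps_nth H (Suc j) * fps_nth (f ^ Suc j) (Suc n)"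
    have t_le: "abs_val (?t j) \<le> B j" if "j < n" for j
      using mult_left_mono[OF coeff_le[of "Suc j" "Suc n"] abs_val_nonneg[of "fps_nth H (Suc j)"]] less[OF that]
      by (simp add: abs_val_mult del: power_Suc)
    have sum_less: "abs_val (\<Sum>j<m. ?t j) < B m" if "m \<le> n" for m
    proof (rule abs_val_sum_less[OF _ B_pos])
      show "abs_val (?t j) < B m" if "j \<in> {..<m}" for j
        using t_le[of j] B_less[of j m] that \<open>m \<le> n\<close> by (simp del: power_Suc)
    qed
    have recursion: "abs_val (fps_nth H (Suc n)) * abs_val (1 - l ^ n) = abs_val (\<Sum>j<n. ?t j)"
    proof -
      have "abs_val (fps_nth H (Suc n)) * abs_val (l * (1 - l ^ n)) = abs_val (\<Sum>j<n. ?t j)"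
        using conjugacy_coeff_recursion[OF f0(1) H, of n] f0(2)
        by (simp add: right_diff_distrib flip: abs_val_mult)
      then show ?thesis
        by (simp add: abs_val_mult l1)
    qed
    have first: "fps_nth (f ^ Suc m) (Suc (Suc m)) = of_nat (Suc m) * l ^ m * fps_nth f 2" for m
      using fps_power_nth_add[OF f0(1), of "Suc m" 1] fps_power_nth_first[of "fps_shift 1 f" m] f0(2)
      by (simp add: numeral_2_eq_2)
    consider "n = 0" | "0 < n" "\<not> p dvd n" | "0 < n" "p dvd n"
      by blast
    then show ?case
    proof cases
      case 1
      then show ?thesis
        using H by (simp add: B_def is_conjugacy_def)
    next
      case 2
      then obtain m where m: "n = Suc m"
        by (cases n) auto
      have "abs_val (?t m) = B m"
        unfolding m first using less[of m] abs_val_of_nat_not_dvd[OF 2(2)] a(1)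
        by (simp add: m abs_val_mult abs_val_power l1 del: of_nat_Suc)
      moreover have "abs_val (\<Sum>j<m. ?t j) < B m"
        by (rule sum_less) (simp add: m)
      ultimately have "abs_val (\<Sum>j<n. ?t j) = B m"
        using abs_val_add_eq_left[of "\<Sum>j<m. ?t j" "?t m"] by (simp add: m add.commute)
      then have "abs_val (fps_nth H (Suc n)) * d = B m"
        using recursion dist_1_power_coprime[OF l(2) 2(2)] by (simp only: d_def)
      then have "abs_val (fps_nth H (Suc n)) = B m / d"
        using d(1) by (simp add: eq_divide_eq)
      then show ?thesis
        using B_Suc[of m] 2(2) by (simp add: m)
    next
      case 3
      then have "3 \<le> n"
        using p dvd_imp_le[of p n] by linarith
      then obtain i where i: "n = i + 3"
        by (metis add.commute le_Suc_ex)
      let ?m = "Suc i"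
      have n: "n = Suc (Suc ?m)"
        by (simp add: i)
      have not_dvd: "\<not> p dvd Suc ?m"
      proof
        assume "p dvd Suc ?m"
        then have "p dvd n - Suc ?m"
          using 3(2) by (rule dvd_diff_nat[rotated])
        with p show False
          by (simp add: n)
      qed
      have B_m: "B (Suc ?m) * d = B ?m"
        using B_Suc[OF not_dvd] d by simp
      have "abs_val (?t ?m) = B ?m"
        using abs_val_second_coeff_power[OF p l(2) f a(2), of i] 3(2) less[of ?m]
        by (simp add: i abs_val_mult add.commute numeral_eq_Suc)
      moreover have "abs_val (?t (Suc ?m)) < B ?m"
      proof -
        have "abs_val (?t (Suc ?m)) = B (Suc ?m) * abs_val (of_nat n :: 'a)"
          unfolding n first using less[of "Suc ?m"] a(1)
          by (simp add: n abs_val_mult abs_val_power l1 del: of_nat_Suc)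
        also have "\<dots> < B (Suc ?m) * d"
          using abs_val_of_nat_dvd[OF 3(2)] d B_pos by (intro mult_strict_left_mono) auto
        finally show ?thesis
          by (simp only: B_m)
      qed
      moreover have "abs_val (\<Sum>j<?m. ?t j) < B ?m"
        by (rule sum_less) (simp add: n)
      ultimately have "abs_val (\<Sum>j<n. ?t j) = B ?m"
      proof -
        assume 1: "abs_val (?t ?m) = B ?m" "abs_val (?t (Suc ?m)) < B ?m" "abs_val (\<Sum>j<?m. ?t j) < B ?m"
        have sum_eq: "(\<Sum>j<n. ?t j) = ?t ?m + (?t (Suc ?m) + (\<Sum>j<?m. ?t j))"
          unfolding n sum.lessThan_Suc by (simp only: add_ac)
        have "abs_val (?t (Suc ?m) + (\<Sum>j<?m. ?t j)) < abs_val (?t ?m)"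
          using 1 abs_val_add_le_max[of "?t (Suc ?m)" "\<Sum>j<?m. ?t j"] by linarith
        then show ?thesis
          unfolding sum_eq 1(1)[symmetric] by (rule abs_val_add_eq_left)
      qed
      then have "abs_val (fps_nth H (Suc n)) * abs_val (1 - l ^ n) = B ?m"
        using recursion by simp
      moreover have "B n = B ?m / abs_val (1 - l ^ n)"
        using B_Suc_dvd[of "Suc ?m"] 3(2) B_m unfolding n by (simp del: power_Suc)
      moreover have "abs_val (1 - l ^ n) \<noteq> 0"
        using not_root[rule_format, of n] 3(1) by simp
      ultimately show ?thesis
        by (metis nonzero_mult_div_cancel_right)
    qed
  qed
  then show ?thesis
    by (simp add: B_def d_def)
qed

end

section \<open>Linearization on a disk\<close>

lemma fps_converges_on_iff: "fps_converges_on F D \<longleftrightarrow> (\<forall>x\<in>D. fps_converges_on F {x})"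
  by (simp add: fps_converges_on_def)

lemma gauss_bounded_converges:
  assumes F: "gauss_bounded r F M" and "abs_val x < r"
  shows "fps_converges_on F {x}"
  unfolding fps_converges_on_singleton_iff
proof (rule tendsto_sandwich[OF _ _ tendsto_const])
  have r: "0 < r"
    using assms(2) le_less_trans[OF abs_val_nonneg] by blast
  have "abs_val (fps_nth F n) * abs_val x ^ n \<le> M * (abs_val x / r) ^ n" for n
  proof -
    have "abs_val (fps_nth F n) * abs_val x ^ n = (abs_val (fps_nth F n) * r ^ n) * (abs_val x / r) ^ n"
      using r by (simp add: power_divide)
    also have "\<dots> \<le> M * (abs_val x / r) ^ n"
      using F r by (intro mult_right_mono) (auto simp: gauss_bounded_def)
    finally show ?thesis .
  qed
  then show "\<forall>\<^sub>F n in sequentially. abs_val (fps_nth F n) * abs_val x ^ n \<le> M * (abs_val x / r) ^ n"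
    by simp
  show "(\<lambda>n. M * (abs_val x / r) ^ n) \<longlonglongrightarrow> 0"
    using assms(2) r by (intro tendsto_mult_right_zero LIMSEQ_power_zero) simp
qed simp_all

text \<open>
  A Schwarz lemma: without a constant term, a bound by the radius passes to smaller radii.
\<close>

lemma gauss_bounded_shrink:
  assumes F: "gauss_bounded r F r" "fps_nth F 0 = 0" and \<rho>: "0 \<le> \<rho>" "\<rho> \<le> r" "0 < r"
  shows "gauss_bounded \<rho> F \<rho>"
  unfolding gauss_bounded_def
proof
  fix n
  show "abs_val (fps_nth F n) * \<rho> ^ n \<le> \<rho>"
  proof (cases n)
    case 0
    then show ?thesis
      using F(2) \<rho> by simp
  next
    case (Suc k)
    have "abs_val (fps_nth F n) * r ^ n \<le> r"
      using F(1) by (simp add: gauss_bounded_def)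
    then have "(abs_val (fps_nth F n) * r ^ k) * r \<le> 1 * r"
      by (simp add: Suc mult_ac)
    then have "abs_val (fps_nth F n) * r ^ k \<le> 1"
      using \<rho>(3) by (simp only: mult_le_cancel_right_pos)
    moreover have "abs_val (fps_nth F n) * \<rho> ^ k \<le> abs_val (fps_nth F n) * r ^ k"
      using \<rho> by (intro mult_left_mono power_mono) auto
    ultimately have "(abs_val (fps_nth F n) * \<rho> ^ k) * \<rho> \<le> 1 * \<rho>"
      using \<rho>(1) by (intro mult_right_mono) auto
    then show ?thesis
      by (simp add: Suc mult_ac)
  qed
qed

text \<open>
  The identity \<open>G \<circ> H = X\<close> expresses each coefficient of \<open>G\<close> by earlier ones with weights from the
  powers of \<open>H\<close>, and \<open>H\<^sup>i\<close> has Gauss norm at most \<open>r\<^sup>i\<close>.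
\<close>

lemma gauss_bounded_fps_inv:
  fixes H :: "'a::nonarch_complete_field fps"
  assumes H0: "fps_nth H 0 = 0" and H1: "fps_nth H 1 = 1" and H: "gauss_bounded r H r" and r: "0 < r"
  shows "gauss_bounded r (fps_inv H) r"
proof -
  let ?G = "fps_inv H"
  have "abs_val (fps_nth ?G n) * r ^ n \<le> r" for n
  proof (induction n rule: less_induct)
    case (less n)
    let ?t = "\<lambda>i. fps_nth ?G i * fps_nth (H ^ i) n"
    have "fps_nth (fps_compose ?G H) n = fps_nth fps_X n"
      using fps_inv[OF H0] H1 by simp
    then have "(\<Sum>i<n. ?t i) + fps_nth ?G n * fps_nth H 1 ^ n = fps_nth fps_X n"
      using H0 by (simp add: fps_compose_nth atLeast0AtMost startsby_zero_power_nth_same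
          flip: lessThan_Suc_atMost)
    then have "fps_nth ?G n = fps_nth fps_X n - (\<Sum>i<n. ?t i)"
      using H1 by (simp add: eq_diff_eq add.commute)
    moreover have "abs_val (\<Sum>i<n. ?t i) \<le> r / r ^ n"
    proof (rule abs_val_sum_le)
      fix i
      assume "i \<in> {..<n}"
      then have IH: "abs_val (fps_nth ?G i) * r ^ i \<le> r"
        using less by simp
      have "abs_val (fps_nth (H ^ i) n) * r ^ n \<le> r ^ i"
        using gauss_bounded_power[OF _ H, of i] r by (simp add: gauss_bounded_def)
      then have "abs_val (fps_nth ?G i) * (abs_val (fps_nth (H ^ i) n) * r ^ n) \<le> abs_val (fps_nth ?G i) * r ^ i"
        by (rule mult_left_mono) simp
      with IH have "abs_val (?t i) * r ^ n \<le> r"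
        by (simp add: abs_val_mult mult.assoc)
      then show "abs_val (?t i) \<le> r / r ^ n"
        using r by (simp add: pos_le_divide_eq)
    qed (use r in simp)
    moreover have "abs_val (fps_nth (fps_X :: 'a fps) n) \<le> r / r ^ n"
      using r by (cases "n = 1") auto
    ultimately have "abs_val (fps_nth ?G n) \<le> r / r ^ n"
      using abs_val_diff_le_max[of "fps_nth fps_X n" "\<Sum>i<n. ?t i"] by simp
    then show ?case
      using r by (simp add: pos_le_divide_eq)
  qed
  then show ?thesis
    by (simp add: gauss_bounded_def)
qed

lemma dist_0_abs_val: "dist (0::'a::nonarch_complete_field) x = abs_val x"
  by (simp add: dist_abs_val)

text \<open>
  The bound on \<open>H\<close> says that \<open>H\<close> is an isometry of the disk, and its formal inverse satisfies
  the same bound. Hence all compositions of series involved can be evaluated on the disk.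
\<close>

lemma linearizes_on_ball:
  fixes f H :: "'a::nonarch_complete_field fps"
  assumes f: "gauss_bounded 1 f 1" "fps_nth f 0 = 0" and H: "is_conjugacy f H" "gauss_bounded r H r"
    and r: "0 < r" "r \<le> 1"
  shows "linearizes_on f (ball 0 r)"
  unfolding linearizes_on_def
proof (intro conjI)
  let ?D = "ball (0::'a) r" and ?G = "fps_inv H"
  have H0: "fps_nth H 0 = 0" "fps_nth H 1 = 1" and conj: "fps_compose H f = fps_const (fps_nth f 1) * H"
    using H(1) by (simp_all add: is_conjugacy_def)
  have f_bound: "gauss_bounded (abs_val x) f (abs_val x)" if "x \<in> ?D" for x
    using gauss_bounded_shrink[OF f, of "abs_val x"] that r by (simp add: dist_0_abs_val)
  have H_bound: "gauss_bounded (abs_val x) H (abs_val x)" if "x \<in> ?D" for x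
    using gauss_bounded_shrink[OF H(2) H0(1), of "abs_val x"] that r by (simp add: dist_0_abs_val)
  have f_conv: "fps_converges_on f {x}" if "x \<in> ?D" for x
    using that r by (intro gauss_bounded_converges[OF f(1)]) (simp add: dist_0_abs_val)
  have H_conv: "fps_converges_on H {x}" if "x \<in> ?D" for x
    using that by (intro gauss_bounded_converges[OF H(2)]) (simp add: dist_0_abs_val)
  have G_conv: "fps_converges_on ?G {x}" if "x \<in> ?D" for x
    using that r H0 H(2)
    by (intro gauss_bounded_converges[of r _ r] gauss_bounded_fps_inv) (auto simp: dist_0_abs_val)
  have f_le: "abs_val (fps_value f x) \<le> abs_val x" if "x \<in> ?D" for x
    using f_bound[OF that] f_conv[OF that] by (rule abs_val_fps_value_le)
  have H_le: "abs_val (fps_value H x) \<le> abs_val x" if "x \<in> ?D" for x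
    using H_bound[OF that] H_conv[OF that] by (rule abs_val_fps_value_le)
  show "is_disk ?D"
    using r by (auto simp: is_disk_def)
  show "fps_converges_on f ?D"
    using f_conv by (subst fps_converges_on_iff) blast
  show "fps_value f ` ?D \<subseteq> ?D"
    using f_le by (fastforce simp: dist_0_abs_val)
  have 1: "fps_converges_on H ?D"
    using H_conv by (subst fps_converges_on_iff) blast
  have "fps_value H x \<in> ?D" if "x \<in> ?D" for x
    using H_le[OF that] that by (simp add: dist_0_abs_val)
  then have 2: "fps_converges_on ?G (fps_value H ` ?D)"
    using G_conv by (subst fps_converges_on_iff) blast
  have 3: "\<forall>x\<in>?D. fps_value ?G (fps_value H x) = x"
  proof
    fix x
    assume x: "x \<in> ?D"
    have GH: "fps_compose ?G H = fps_X"
      using fps_inv[OF H0(1)] H0(2) by simp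
    have "fps_value (fps_compose ?G H) x = fps_value ?G (fps_value H x)"
      using G_conv[OF x] fps_value_X[of x] unfolding fps_converges_on_singleton_iff[of ?G]
      by (intro fps_value_compose[OF H0(1) H_conv[OF x] _ H_bound[OF x]]) (simp_all add: GH)
    then show "fps_value ?G (fps_value H x) = x"
      using fps_value_X[of x] by (simp add: GH)
  qed
  have 4: "\<forall>x\<in>?D. fps_value H (fps_value f x) = fps_nth f 1 * fps_value H x"
  proof
    fix x
    assume x: "x \<in> ?D"
    note lH = fps_value_mult[OF conjunct1[OF fps_value_const] H_conv[OF x], of "fps_nth f 1"]
    have "fps_value (fps_compose H f) x = fps_value H (fps_value f x)"
      using H_conv[OF x] lH unfolding fps_converges_on_singleton_iff[of H]
      by (intro fps_value_compose[OF f(2) f_conv[OF x] _ f_bound[OF x]]) (simp_all add: conj)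
    then show "fps_value H (fps_value f x) = fps_nth f 1 * fps_value H x"
      using lH fps_value_const[of "fps_nth f 1" x] by (simp add: conj)
  qed
  show "\<exists>H G. is_conjugacy f H \<and> fps_converges_on H ?D \<and> fps_converges_on G (fps_value H ` ?D)
      \<and> (\<forall>x\<in>?D. fps_value G (fps_value H x) = x)
      \<and> (\<forall>x\<in>?D. fps_value H (fps_value f x) = fps_nth f 1 * fps_value H x)"
    using H(1) 1 2 3 4 by blast
qed

text \<open>
  A disk that is not contained in \<open>ball 0 r\<close> contains a point \<open>x\<close> with \<open>|x| \<ge> r\<close>. If the terms of
  \<open>H\<close> do not tend to 0 at distance \<open>r\<close>, then \<open>H\<close> diverges there.
\<close>

lemma linearization_disk_maximal:
  fixes f :: "'a::nonarch_complete_field fps"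
  assumes D: "linearizes_on f D" and r: "0 < r" and c: "0 < c"
    and large: "\<And>H N. is_conjugacy f H \<Longrightarrow> \<exists>n\<ge>N. c \<le> abs_val (fps_nth H n) * r ^ n"
  shows "D \<subseteq> ball 0 r"
proof (rule subsetI, rule ccontr)
  fix x
  assume "x \<in> D" "x \<notin> ball 0 r"
  obtain H where H: "is_conjugacy f H" "fps_converges_on H D"
    using D by (auto simp: linearizes_on_def)
  have "fps_converges_on H {x}"
    using H(2) \<open>x \<in> D\<close> by (simp add: fps_converges_on_def)
  then have "eventually (\<lambda>n. abs_val (fps_nth H n) * abs_val x ^ n < c) sequentially"
    unfolding fps_converges_on_singleton_iff using c by (rule order_tendstoD)
  then obtain N where N: "\<And>n. n \<ge> N \<Longrightarrow> abs_val (fps_nth H n) * abs_val x ^ n < c"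
    by (auto simp: eventually_sequentially)
  obtain n where n: "n \<ge> N" "c \<le> abs_val (fps_nth H n) * r ^ n"
    using large[OF H(1)] by blast
  have "abs_val (fps_nth H n) * r ^ n \<le> abs_val (fps_nth H n) * abs_val x ^ n"
    using \<open>x \<notin> ball 0 r\<close> r by (intro mult_left_mono power_mono) (simp_all add: dist_0_abs_val)
  with N[OF n(1)] n(2) show False
    by linarith
qed

context padic_valued_field
begin

lemma is_linearization_disk_ball:
  fixes f :: "'a fps" and s :: nat
  assumes p: "3 \<le> p" and l: "1 / p < abs_val (1 - l)" "abs_val (1 - l) < 1"
    and not_root: "\<forall>n\<ge>1. l ^ n \<noteq> 1"
    and s: "abs_val (1 - l ^ (p ^ s)) < root_dist p 1"
    and f: "f \<in> indifferent_series l"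
    and a: "abs_val (fps_nth f 2) = 1" "abs_val ((fps_nth f 2)\<^sup>2 - fps_nth f 3) = 1"
  shows "is_linearization_disk f
    (ball 0 (abs_val (1 - l) powr (- 1 / p) * small_divisor_rate p s l))"
proof -
  define r where "r = abs_val (1 - l) powr (- 1 / p) * small_divisor_rate p s l"
  let ?d = "abs_val (1 - l)" and ?S = "small_divisor_product l"
  have f0: "fps_nth f 0 = 0" "fps_nth f 1 = l"
    using f by (simp_all add: indifferent_series_def)
  have l1: "abs_val l = 1"
    using l(2) by (rule abs_val_eq_1_of_near_1)
  have f_bound: "gauss_bounded 1 f 1"
    using indifferent_series_gauss_bounded[OF f] l1 by simp
  have d: "0 < ?d"
    using l(1) p by (auto intro: le_less_trans[rotated])
  have S: "0 < ?S n" for n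
    using not_root by (rule small_divisor_product_pos)
  have r: "0 < r"
    unfolding r_def using d small_divisor_rate_pos[OF not_root] by simp
  note lower = small_divisor_product_gain_lower[OF l s not_root, folded r_def]
  note exact = small_divisor_product_gain_exact[OF l s not_root, folded r_def]
  have coeff: "abs_val (fps_nth H (Suc n)) = ?d ^ (n div p) / ?S n" if "is_conjugacy f H" for H n
    using p l not_root f a that by (rule abs_val_conjugacy_coeff)
  have r_le: "r \<le> 1"
    using lower[of 1] p l(2) by (simp add: small_divisor_product_def)
  obtain H where H: "is_conjugacy f H"
    using conjugacy_exists[of f] f0 l1 not_root by fastforce
  have "abs_val (fps_nth H n) * r ^ n \<le> r" for n
  proof (cases n)
    case 0
    then show ?thesis
      using H r by (simp add: is_conjugacy_def)
  next
    case (Suc k)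
    have "abs_val (fps_nth H n) * r ^ k = r ^ k * ?d ^ (k div p) / ?S k"
      by (simp add: Suc coeff[OF H])
    also have "\<dots> \<le> 1"
      using lower[of k] S[of k] by (simp add: divide_le_eq)
    finally have "r * (abs_val (fps_nth H n) * r ^ k) \<le> r * 1"
      using r by (intro mult_left_mono) auto
    then show ?thesis
      by (simp add: Suc mult_ac)
  qed
  then have "gauss_bounded r H r"
    by (simp add: gauss_bounded_def)
  then have "linearizes_on f (ball 0 r)"
    using f_bound f0(1) H r r_le by (intro linearizes_on_ball)
  moreover have "D \<subseteq> ball 0 r" if D: "linearizes_on f D" for D
    using D r
  proof (rule linearization_disk_maximal)
    show "0 < root_dist p 1 * r"
      using r root_dist_pos[of 1] by simp
    fix H N
    assume H: "is_conjugacy f H"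
    \<comment> \<open>Along the indices \<open>p\<^sup>k + 1\<close> the terms have constant size at distance \<open>r\<close>.\<close>
    let ?n = "p ^ Suc (N + s)"
    have "abs_val (fps_nth H (Suc ?n)) * r ^ Suc ?n = (r ^ ?n * ?d ^ (p ^ (N + s))) / ?S ?n * r"
      using p_gt_1 by (simp add: coeff[OF H])
    also have "\<dots> = root_dist p 1 * r"
      unfolding exact using S[of ?n] by simp
    finally have "root_dist p 1 * r \<le> abs_val (fps_nth H (Suc ?n)) * r ^ Suc ?n"
      by (rule eq_refl[OF sym])
    moreover have "N \<le> Suc ?n"
    proof -
      have "Suc (N + s) < p ^ Suc (N + s)"
        using power_gt_expt[of p "Suc (N + s)"] p_gt_1 by simp
      then show ?thesis
        by linarith
    qed
    ultimately show "\<exists>n\<ge>N. root_dist p 1 * r \<le> abs_val (fps_nth H n) * r ^ n"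
      by blast
  qed
  ultimately show ?thesis
    by (simp add: is_linearization_disk_def r_def)
qed

end

section \<open>Roots of unity and values in the field of complex p-adic numbers\<close>

lemma rational_imp_padic_algebraic:
  assumes "c \<in> \<rat>"
  shows "c \<in> (padic_algebraic_numbers :: 'a::nonarch_complete_field set)"
proof -
  have "coeff [:- c, 1:] i \<in> \<rat>" for i
    using assms by (cases i) (auto simp: coeff_pCons split: nat.split)
  then have "coeff [:- c, 1:] i \<in> padic_numbers" for i
    unfolding padic_numbers_def using closure_subset by blast
  then show ?thesis
    unfolding padic_algebraic_numbers_def
    by (intro CollectI exI[of _ "[:- c, 1:]"]) auto
qed

lemma complex_padics_rational_poly_root:
  fixes P :: "'a::nonarch_complete_field poly"
  assumes "is_complex_padics p TYPE('a)" "0 < degree P" "\<And>i. coeff P i \<in> \<rat>"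
  obtains x where "poly P x = 0"
  using assms rational_imp_padic_algebraic unfolding is_complex_padics_def by meson

text \<open>
  Such a root is a zero of the cyclotomic polynomial \<open>1 + X\<^sup>q + \<dots> + X\<^bsup>(p-1)q\<^esup>\<close> with \<open>q = p\<^sup>t\<close>,
  which divides \<open>X\<^bsup>pq\<^esup> - 1\<close> and takes the value \<open>p\<close> wherever \<open>X\<^sup>q = 1\<close>.
\<close>

lemma complex_padics_primitive_root:
  assumes C: "is_complex_padics p TYPE('a::nonarch_complete_field)"
  obtains z :: "'a::nonarch_complete_field" where "z ^ (p ^ Suc t) = 1" "z ^ (p ^ t) \<noteq> 1"
proof -
  let ?q = "p ^ t"
  define P :: "'a poly" where "P = (\<Sum>i<p. monom 1 (i * ?q))"
  have p: "1 < p"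
    using C prime_gt_1_nat by (auto simp: is_complex_padics_def)
  have poly_P: "poly P x = (\<Sum>i<p. (x ^ ?q) ^ i)" for x
    by (simp add: P_def poly_sum poly_monom mult.commute flip: power_mult)
  have "coeff P j \<in> \<rat>" for j
    unfolding P_def coeff_sum coeff_monom by (intro Rats_sum) auto
  moreover have "0 < degree P"
  proof (rule ccontr)
    assume "\<not> 0 < degree P"
    then obtain c where "P = [:c:]"
      by (metis degree_eq_zeroE neq0_conv)
    then have "poly P 1 = poly P 0"
      by simp
    moreover have "poly P 0 = 1"
      unfolding poly_P using p by (simp add: zero_power power_0_left sum.delta)
    moreover have "poly P 1 = of_nat p"
      by (simp add: poly_P)
    ultimately show False
      using p by simp
  qed
  ultimately obtain z where z: "poly P z = 0"
    using C by (rule_tac complex_padics_rational_poly_root) auto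
  have "z ^ ?q \<noteq> 1"
  proof
    assume "z ^ ?q = 1"
    then have "poly P z = of_nat p"
      by (simp add: poly_P)
    with z p show False
      by simp
  qed
  moreover have "1 - (z ^ ?q) ^ p = 0"
    using z unfolding poly_P one_diff_power_eq by simp
  then have "z ^ (p ^ Suc t) = 1"
    by (simp add: power_mult[symmetric] mult.commute)
  ultimately show ?thesis
    using that by blast
qed

lemma power_minus_1_eq_prod_roots:
  fixes z :: "'a::field"
  assumes q: "0 < q" and z: "z ^ q = 1" and inj: "inj_on (\<lambda>i. z ^ i) {..<q}"
  shows "x ^ q - 1 = (\<Prod>i<q. x - z ^ i)"
proof -
  let ?P = "monom 1 q - 1 :: 'a poly" and ?Q = "\<Prod>i<q. [:- (z ^ i), 1:]"
  have "?P = ?Q"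
  proof (rule ccontr)
    assume "?P \<noteq> ?Q"
    then have neq: "?P - ?Q \<noteq> 0"
      by simp
    have degQ: "degree ?Q = q"
      by (subst degree_prod_eq_sum_degree) auto
    have "lead_coeff ?Q = 1"
      by (simp add: lead_coeff_prod)
    then have "coeff (?P - ?Q) q = 0"
      using q by (simp add: degQ)
    moreover have "degree (?P - ?Q) \<le> q"
      using degQ by (intro degree_diff_le) (auto intro: degree_monom_le)
    ultimately have "degree (?P - ?Q) < q"
      using neq by (metis le_neq_implies_less leading_coeff_0_iff)
    moreover have "q \<le> degree (?P - ?Q)"
    proof -
      have "poly (?P - ?Q) (z ^ i) = 0" if "i < q" for i
      proof -
        have "(z ^ i) ^ q = 1"
          using z by (metis mult.commute power_mult power_one)
        moreover have "(\<Prod>j<q. z ^ i - z ^ j) = 0"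
          using that by (auto intro: prod_zero)
        ultimately show ?thesis
          by (simp add: poly_monom poly_prod)
      qed
      then have "(\<lambda>i. z ^ i) ` {..<q} \<subseteq> {x. poly (?P - ?Q) x = 0}"
        by auto
      then have "card ((\<lambda>i. z ^ i) ` {..<q}) \<le> card {x. poly (?P - ?Q) x = 0}"
        by (intro card_mono poly_roots_finite neq)
      also have "\<dots> \<le> degree (?P - ?Q)"
        by (rule card_poly_roots_bound[OF neq])
      finally show ?thesis
        by (simp add: card_image[OF inj])
    qed
    ultimately show False
      by simp
  qed
  then have "poly ?P x = poly ?Q x"
    by simp
  then show ?thesis
    by (simp add: poly_monom poly_prod)
qed

lemma complex_padics_power_minus_1:
  fixes x :: "'a::nonarch_complete_field"
  assumes C: "is_complex_padics p TYPE('a)"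
  obtains z where "\<And>i. z i \<in> p_power_roots_of_unity p" "x ^ (p ^ t) - 1 = (\<Prod>i<p ^ t. x - z i)"
proof (cases t)
  case 0
  show ?thesis
    by (rule that[of "\<lambda>_. 1"]) (auto simp: p_power_roots_of_unity_def 0)
next
  case (Suc u)
  have p: "prime p"
    using C by (simp add: is_complex_padics_def)
  obtain z :: 'a where z: "z ^ (p ^ Suc u) = 1" "z ^ (p ^ u) \<noteq> 1"
    using C by (rule complex_padics_primitive_root)
  have z0: "z \<noteq> 0"
    using z(1) prime_gt_0_nat[OF p] by (metis power_eq_0_iff zero_neq_one zero_less_power neq0_conv)
  have neq: "z ^ i \<noteq> z ^ j" if ij: "i < j" "j < p ^ Suc u" for i j
  proof
    assume "z ^ i = z ^ j"
    moreover have "z ^ i * z ^ (j - i) = z ^ j"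
      using ij by (simp flip: power_add)
    ultimately have "z ^ i * 1 = z ^ i * z ^ (j - i)"
      by simp
    then have one: "z ^ (j - i) = 1"
      using z0 by (simp only: mult_cancel_left) simp
    obtain k where k: "k \<le> Suc u" "gcd (j - i) (p ^ Suc u) = p ^ k"
      using divides_primepow_nat[OF p, of "gcd (j - i) (p ^ Suc u)" "Suc u"] by auto
    have "p ^ k \<le> j - i"
      using ij k(2) by (metis gcd_le1_nat nat_less_le zero_less_diff)
    then have "p ^ k < p ^ Suc u"
      using ij by simp
    then have "k \<le> u"
      using prime_gt_1_nat[OF p] by (simp add: power_strict_increasing_iff del: power_Suc)
    obtain v w where vw: "(j - i) * v = (p ^ Suc u) * w + p ^ k"
      using bezout_nat[of "j - i" "p ^ Suc u"] ij k(2) by auto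
    have "z ^ (p ^ k) = z ^ ((p ^ Suc u) * w + p ^ k)"
      by (simp only: power_add power_mult z(1) power_one mult_1)
    also have "\<dots> = 1"
      unfolding vw[symmetric] by (simp add: power_mult one)
    finally have "z ^ (p ^ k) = 1" .
    then have "z ^ (p ^ k * p ^ (u - k)) = 1"
      by (simp add: power_mult)
    then show False
      using z(2) \<open>k \<le> u\<close> by (simp flip: power_add)
  qed
  have "inj_on (\<lambda>i. z ^ i) {..<p ^ t}"
    using neq by (intro inj_onI) (metis Suc lessThan_iff linorder_neqE_nat)
  then have "x ^ (p ^ t) - 1 = (\<Prod>i<p ^ t. x - z ^ i)"
    using z(1) prime_gt_0_nat[OF p] by (intro power_minus_1_eq_prod_roots) (simp_all add: Suc)
  moreover have "z ^ i \<in> p_power_roots_of_unity p" for i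
    unfolding p_power_roots_of_unity_def
    using z(1) by (intro CollectI exI[of _ "Suc u"]) (metis mult.commute power_mult power_one)
  ultimately show ?thesis
    using that[of "\<lambda>i. z ^ i"] by blast
qed

lemma abs_val_power_int:
  "abs_val (x powi k) = abs_val (x::'a::nonarch_complete_field) powi k"
  by (simp add: power_int_def abs_val_power abs_val_inverse)

text \<open>The \<open>n\<close>-th roots of \<open>p\<close> and their powers have the absolute values \<open>p\<^bsup>k/n\<^esup>\<close>.\<close>

lemma complex_padics_values_dense:
  assumes C: "is_complex_padics p TYPE('a::nonarch_complete_field)" and ab: "0 < a" "a < b"
  obtains x :: "'a::nonarch_complete_field" where "a < abs_val x" "abs_val x < b"
proof -
  have p: "1 < p"
    using C prime_gt_1_nat by (auto simp: is_complex_padics_def)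
  have lnp: "0 < ln (real p)"
    using p by simp
  have "0 < ln b - ln a"
    using ab by simp
  then obtain n where n: "ln (real p) < real n * (ln b - ln a)"
    using reals_Archimedean3 by blast
  have n0: "0 < n"
  proof (rule ccontr)
    assume "\<not> 0 < n"
    with n lnp show False
      by simp
  qed
  define c where "c = ln (real p) / n"
  have c: "0 < c" "c < ln b - ln a"
    using n n0 lnp by (simp_all add: c_def pos_divide_less_eq mult.commute)
  let ?P = "monom 1 n - [:of_nat p:] :: 'a poly"
  have "coeff ?P i \<in> \<rat>" for i
    by (cases i) (auto simp: coeff_pCons split: nat.split)
  moreover have "coeff ?P n = 1"
    using n0 by (cases n) simp_all
  then have "0 < degree ?P"
    using n0 le_degree[of ?P n] by simp
  ultimately obtain y where y: "poly ?P y = 0"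
    using C by (rule_tac complex_padics_rational_poly_root) auto
  then have "y ^ n = of_nat p"
    by (simp add: poly_monom)
  then have "abs_val y ^ n = 1 / p"
    using C by (simp add: is_complex_padics_def flip: abs_val_power)
  moreover have "y \<noteq> 0"
    using \<open>y ^ n = of_nat p\<close> n0 p by (auto simp: power_0_left)
  ultimately have "real n * ln (abs_val y) = - ln (real p)"
    using p by (simp add: ln_div flip: ln_realpow)
  then have ln_y: "ln (abs_val y) = - c"
    using n0 by (simp add: c_def field_simps)
  define k where "k = \<lfloor>ln a / c\<rfloor> + 1"
  have "ln a / c < k" "k \<le> ln a / c + 1"
    by (simp_all add: k_def)
  then have k: "ln a < k * c" "k * c < ln b"
    using c by (simp_all add: pos_divide_less_eq field_simps)
  have "abs_val (y powi (- k)) = exp (k * c)"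
  proof -
    have "abs_val (y powi (- k)) = abs_val y powr (of_int (- k))"
      using powr_real_of_int'[of "abs_val y" "- k"] \<open>y \<noteq> 0\<close> by (simp add: abs_val_power_int)
    also have "\<dots> = exp (k * c)"
      using \<open>y \<noteq> 0\<close> by (simp add: powr_def ln_y)
    finally show ?thesis .
  qed
  moreover have "a < exp (k * c)" "exp (k * c) < b"
    using k ab by (metis exp_less_cancel_iff exp_ln order_less_trans)+
  ultimately show ?thesis
    using that[of "y powi (- k)"] by simp
qed

lemma complex_padics_ball_radius_unique:
  assumes C: "is_complex_padics p TYPE('a::nonarch_complete_field)" and r: "0 < r" "0 < r'"
    and eq: "ball (0::'a) r = ball 0 r' \<or> ball (0::'a) r = cball 0 r'"
  shows "r' = r"
proof (rule ccontr)
  assume "r' \<noteq> r"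
  then have "min r r' < max r r'"
    by linarith
  then obtain x :: 'a where x: "min r r' < abs_val x" "abs_val x < max r r'"
    using complex_padics_values_dense[OF C, of "min r r'" "max r r'"] r by auto
  from eq have "(x \<in> ball 0 r \<longleftrightarrow> x \<in> ball 0 r') \<or> (x \<in> ball 0 r \<longleftrightarrow> x \<in> cball 0 r')"
    by metis
  then have "(abs_val x < r \<longleftrightarrow> abs_val x < r') \<or> (abs_val x < r \<longleftrightarrow> abs_val x \<le> r')"
    by (simp add: dist_0_abs_val)
  with x show False
    by (auto simp: min_def max_def split: if_splits)
qed

section \<open>The rate and the exact radius\<close>

context padic_valued_field
begin

text \<open>
  After at most \<open>s\<close> \<open>p\<close>-th powers the distance to 1 is below \<open>R(1)\<close>. From then on each \<open>p\<close>-th power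
  only divides it by \<open>p\<close>, so it can vanish later only if it vanishes already.
\<close>

lemma p_power_root_order_bound:
  fixes x :: 'a
  assumes x: "abs_val (1 - x) < root_dist p (Suc s)" and "x \<in> p_power_roots_of_unity p"
  shows "x ^ (p ^ s) = 1"
proof -
  obtain k where k: "x ^ (p ^ k) = 1"
    using assms(2) by (auto simp: p_power_roots_of_unity_def)
  define i where "i = root_level p (abs_val (1 - x))"
  have i: "root_dist p i \<le> abs_val (1 - x)" "abs_val (1 - x) < root_dist p (Suc i)"
    using root_level[of "abs_val (1 - x)"] x root_dist_less_1[of "Suc s"] by (simp_all add: i_def)
  have "i \<le> s"
    using i x root_dist_mono[of "Suc s" i] by (meson not_less_eq_eq le_less_trans less_irrefl order_trans)
  have one: "x ^ (p ^ n) = 1" if "x ^ (p ^ m) = 1" "m \<le> n" for m n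
  proof -
    have "p ^ n = p ^ m * p ^ (n - m)"
      using that by (simp flip: power_add)
    then show ?thesis
      using that by (simp add: power_mult)
  qed
  have "x ^ (p ^ i) = 1"
  proof -
    have "x ^ (p ^ (i + k)) = 1"
      using k by (rule one) simp
    then have "1 - (x ^ (p ^ i)) ^ (p ^ k) = 0"
      by (simp add: power_add power_mult)
    moreover have "abs_val (1 - (x ^ (p ^ i)) ^ (p ^ k)) = abs_val (1 - x ^ (p ^ i)) / p ^ k"
      using i by (intro dist_1_power_tower_small dist_1_power_tower_below_threshold)
    ultimately show ?thesis
      using p_gt_1 by simp
  qed
  then show ?thesis
    using \<open>i \<le> s\<close> by (rule one)
qed

text \<open>
  Roots of unity of order a power of \<open>p\<close> that are at least as close to \<open>l\<close> as 1 is lie in a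
  finite group, so that a closest one exists.
\<close>

lemma nearest_p_power_root:
  fixes l :: 'a
  assumes l: "abs_val (1 - l) < root_dist p (Suc s)"
  defines "g \<equiv> ARG_MIN (\<lambda>g. abs_val (g - l)) g. g \<in> p_power_roots_of_unity p"
  shows "g ^ (p ^ s) = 1" "\<And>z. z \<in> p_power_roots_of_unity p \<Longrightarrow> abs_val (g - l) \<le> abs_val (z - l)"
    and "g \<in> p_power_roots_of_unity p"
proof -
  let ?G = "p_power_roots_of_unity p :: 'a set"
  let ?S = "{z \<in> ?G. abs_val (z - l) \<le> abs_val (1 - l)}"
  have order: "z ^ (p ^ s) = 1" if z: "z \<in> ?S" for z
  proof (rule p_power_root_order_bound)
    have "abs_val (1 - z) \<le> max (abs_val (1 - l)) (abs_val (l - z))"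
      using abs_val_add_le_max[of "1 - l" "l - z"] by simp
    then show "abs_val (1 - z) < root_dist p (Suc s)"
      using z l by (simp add: abs_val_minus_commute[of l z])
  qed (use z in simp)
  have "0 < p ^ s"
    using p_gt_1 by simp
  have "finite {z :: 'a. poly (monom 1 (p ^ s) - 1) z = 0}"
  proof (rule poly_roots_finite)
    have "coeff (monom 1 (p ^ s) - 1 :: 'a poly) (p ^ s) = 1"
      using \<open>0 < p ^ s\<close> by simp
    then show "monom 1 (p ^ s) - 1 \<noteq> (0 :: 'a poly)"
      by (metis coeff_0 zero_neq_one)
  qed
  moreover have "?S \<subseteq> {z. poly (monom 1 (p ^ s) - 1) z = 0}"
    using order by (auto simp: poly_monom)
  ultimately have "finite ?S"
    by (rule finite_subset[rotated])
  moreover have "1 \<in> ?S"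
    by (auto simp: p_power_roots_of_unity_def)
  ultimately obtain h where "is_arg_min (\<lambda>g. abs_val (g - l)) (\<lambda>z. z \<in> ?S) h"
    using ex_is_arg_min_if_finite[of ?S] by blast
  then have "is_arg_min (\<lambda>g. abs_val (g - l)) (\<lambda>z. z \<in> ?G) h"
    unfolding is_arg_min_def by (smt (verit) mem_Collect_eq)
  then have g: "is_arg_min (\<lambda>g. abs_val (g - l)) (\<lambda>z. z \<in> ?G) g"
    unfolding g_def arg_min_def by (rule someI)
  then show "g \<in> ?G" and min: "\<And>z. z \<in> ?G \<Longrightarrow> abs_val (g - l) \<le> abs_val (z - l)"
    by (auto simp: is_arg_min_def not_less)
  from min[of 1] have "g \<in> ?S"
    using \<open>g \<in> ?G\<close> \<open>1 \<in> ?S\<close> by simp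
  then show "g ^ (p ^ s) = 1"
    by (rule order)
qed

text \<open>
  If \<open>|1 - x| > R(t)\<close>, then \<open>|1 - x|\<close> is raised to the \<open>p\<close>-th power \<open>t\<close> times. On the boundary
  \<open>|1 - x| = R(t)\<close> this can fail, namely if a \<open>p\<^sup>t\<close>-th root of unity is closer to \<open>x\<close>
  than 1 is; the factorization of \<open>x\<^bsup>p^t\<^esup> - 1\<close> shows that this is the only reason.
\<close>

lemma dist_1_power_tower_nearest:
  fixes x :: 'a
  assumes C: "is_complex_padics p TYPE('a)"
    and x: "root_dist p t \<le> abs_val (1 - x)" "abs_val (1 - x) < 1"
    and near: "\<And>z. z \<in> p_power_roots_of_unity p \<Longrightarrow> abs_val (1 - x) \<le> abs_val (z - x)"
  shows "abs_val (1 - x ^ (p ^ t)) = abs_val (1 - x) ^ (p ^ t)"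
proof (rule antisym)
  show "abs_val (1 - x ^ (p ^ t)) \<le> abs_val (1 - x) ^ (p ^ t)"
    using x by (intro dist_1_power_tower_le) auto
  obtain z where z: "\<And>i. z i \<in> p_power_roots_of_unity p" "x ^ (p ^ t) - 1 = (\<Prod>i<p ^ t. x - z i)"
    using complex_padics_power_minus_1[OF C, of x t] by blast
  have "abs_val (1 - x) ^ (p ^ t) = (\<Prod>i<p ^ t. abs_val (1 - x))"
    by simp
  also have "\<dots> \<le> (\<Prod>i<p ^ t. abs_val (x - z i))"
    using near[OF z(1)] by (intro prod_mono) (auto simp: abs_val_minus_commute[of x])
  also have "\<dots> = abs_val (x ^ (p ^ t) - 1)"
    by (simp add: z(2) abs_val_prod)
  finally show "abs_val (1 - x) ^ (p ^ t) \<le> abs_val (1 - x ^ (p ^ t))"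
    by (simp add: abs_val_minus_commute)
qed

text \<open>
  Dividing \<open>l\<close> by the nearest root of unity \<open>g\<close> changes no power \<open>l\<^bsup>p^s\<^esup>\<close>, as \<open>g\<^bsup>p^s\<^esup> = 1\<close>.
  For the quotient, the first \<open>t\<close> of the \<open>p\<close>-th powers raise the distance to 1 to the power \<open>p\<close>,
  and the other \<open>s - t\<close> divide it by \<open>p\<close>.
\<close>

lemma r_tilde_eq_small_divisor_rate:
  fixes l :: 'a
  assumes C: "is_complex_padics p TYPE('a)"
    and l: "abs_val (1 - l) < 1" and not_root: "\<forall>n\<ge>1. l ^ n \<noteq> 1"
  shows "r_tilde p l = small_divisor_rate p (root_level p (abs_val (1 - l))) l"
proof -
  define d where "d = abs_val (1 - l)"
  define s where "s = root_level p d"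
  define g where "g = (ARG_MIN (\<lambda>g. abs_val (g - l)) g. g \<in> p_power_roots_of_unity p)"
  define e where "e = abs_val (g - l)"
  define t where "t = root_level p e"
  have s: "root_dist p s \<le> d" "d < root_dist p (Suc s)"
    using root_level[of d] l by (simp_all add: s_def d_def)
  note g = nearest_p_power_root[of l s, folded g_def, folded d_def, OF s(2)]
  have g_root: "g ^ (p ^ s) = 1"
    by (rule g(1))
  have "abs_val g ^ (p ^ s) = 1"
    using g_root by (simp flip: abs_val_power)
  then have g1: "abs_val g = 1"
    using p_gt_1 by (metis abs_val_nonneg power_eq_1_iff zero_less_power less_trans zero_less_one abs_of_nonneg real_norm_def neq0_conv)
  have e_le: "e \<le> d"
    using g(2)[of 1] by (simp add: e_def d_def p_power_roots_of_unity_def)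
  then have e1: "e < 1"
    using l by (simp add: d_def)
  have t: "root_dist p t \<le> e" "e < root_dist p (Suc t)"
    using root_level[of e] e1 by (simp_all add: t_def e_def)
  have "t \<le> s"
    using t(1) e_le s(2) root_dist_mono[of "Suc s" t] by (meson not_less_eq_eq le_less_trans less_irrefl order_trans)
  define x where "x = l / g"
  have g0: "g \<noteq> 0"
    using g1 by auto
  have dist_x: "abs_val (z - x) = abs_val (z * g - l)" for z
  proof -
    have "z * g - l = (z - x) * g"
      using g0 by (simp add: x_def field_simps)
    then show ?thesis
      by (simp add: abs_val_mult g1)
  qed
  have x_e: "abs_val (1 - x) = e"
    using dist_x[of 1] by (simp add: e_def)
  have near: "abs_val (1 - x) \<le> abs_val (z - x)" if z: "z \<in> p_power_roots_of_unity p" for z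
  proof -
    obtain i where i: "z ^ (p ^ i) = 1"
      using z by (auto simp: p_power_roots_of_unity_def)
    have "(z * g) ^ (p ^ (i + s)) = (z ^ (p ^ i)) ^ (p ^ s) * (g ^ (p ^ s)) ^ (p ^ i)"
      by (simp add: power_mult_distrib power_add power_mult[symmetric] mult.commute)
    also have "\<dots> = 1"
      by (simp add: i g_root)
    finally have "z * g \<in> p_power_roots_of_unity p"
      by (auto simp: p_power_roots_of_unity_def)
    then show ?thesis
      using g(2)[of "z * g"] by (simp only: dist_x[of z] x_e e_def)
  qed
  have "abs_val (1 - x ^ (p ^ t)) = e ^ (p ^ t)"
    unfolding x_e[symmetric] using C t(1) e1 near
    by (intro dist_1_power_tower_nearest) (simp_all add: x_e)
  moreover have "abs_val (1 - x ^ (p ^ t)) < root_dist p 1"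
    using t by (intro dist_1_power_tower_below_threshold) (simp_all add: x_e)
  then have "abs_val (1 - (x ^ (p ^ t)) ^ (p ^ (s - t))) = abs_val (1 - x ^ (p ^ t)) / p ^ (s - t)"
    by (rule dist_1_power_tower_small)
  moreover have "(x ^ (p ^ t)) ^ (p ^ (s - t)) = l ^ (p ^ s)"
  proof -
    have "(x ^ (p ^ t)) ^ (p ^ (s - t)) = x ^ (p ^ s)"
      using \<open>t \<le> s\<close> by (simp flip: power_mult power_add)
    then show ?thesis
      using g_root by (simp add: x_def power_divide)
  qed
  ultimately have level: "abs_val (1 - l ^ (p ^ s)) = e ^ (p ^ t) / p ^ (s - t)"
    by simp
  have e0: "0 < e"
  proof -
    have "abs_val (1 - l ^ (p ^ s)) \<noteq> 0"
      using not_root[rule_format, of "p ^ s"] p_gt_1 by simp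
    then show ?thesis
      using level p_gt_1 by (auto simp: e_def)
  qed
  have level_powr: "abs_val (1 - l ^ (p ^ s)) powr (1 / real p ^ s)
      = p powr (- (real s - real t) / real p ^ s) * e powr (1 / p powr (real s - real t))"
  proof -
    have pp: "0 < real p"
      using p_gt_1 by simp
    have "abs_val (1 - l ^ (p ^ s)) = e powr (real p ^ t) * p powr (- (real s - real t))"
    proof -
      have "e ^ (p ^ t) = e powr (real p ^ t)"
        using powr_realpow[OF e0, of "p ^ t"] by simp
      moreover have "real p ^ (s - t) = p powr (real s - real t)"
        using powr_realpow[OF pp, of "s - t"] \<open>t \<le> s\<close> by (simp add: of_nat_diff)
      ultimately show ?thesis
        unfolding level powr_minus_divide by simp
    qed
    moreover have "real p ^ t / real p ^ s = 1 / p powr (real s - real t)"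
      using pp by (simp add: powr_diff powr_realpow)
    ultimately show ?thesis
      using e0 pp by (simp add: powr_mult powr_powr mult.commute)
  qed
  have m: "(LEAST n. n \<ge> 1 \<and> abs_val (1 - l ^ n) < 1) = 1"
    using l by (intro Least_equality) auto
  have "r_tilde p l = root_dist p (Suc s) * p powr (- (real s - real t) / real p ^ s)
      * d powr (real s * (real p - 1) / p) * e powr (1 / p powr (real s - real t))"
    unfolding r_tilde_def m Let_def power_one_right
    unfolding d_def[symmetric] unfolding s_def[symmetric] unfolding g_def[symmetric]
    unfolding e_def[symmetric] unfolding t_def[symmetric]
    using root_dist_pos[of "Suc s"] by simp
  also have "\<dots> = small_divisor_rate p s l"
    using small_divisor_rate_closed_form[OF not_root, of s]
      dist_1_power_tower_eq[of s l] s(1) l level_powr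
    by (simp add: d_def mult_ac)
  finally show ?thesis
    by (simp add: s_def d_def)
qed

end

section \<open>The linearization disk\<close>

lemma quadratic_series_indifferent:
  "quadratic_series l \<in> indifferent_series l"
  "fps_nth (quadratic_series l) 2 = 1" "fps_nth (quadratic_series l) 3 = 0"
  by (auto simp: indifferent_series_def quadratic_series_def fps_X_power_iff)

theorem corollary1p0p1:
  fixes p :: nat and l :: "'a::nonarch_complete_field" and f :: "'a fps"
  assumes "is_complex_padics p TYPE('a)"
    and "p \<ge> 3"
    and "\<forall>n\<ge>1. l ^ n \<noteq> 1"
    and "1 / real p < abs_val (1 - l)" and "abs_val (1 - l) < 1"
    and "f \<in> indifferent_series l"
    and "abs_val (fps_nth f 2) = 1"
    and "abs_val ((fps_nth f 2)\<^sup>2 - fps_nth f 3) = 1"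
  shows "is_linearization_disk f (linearization_disk f) \<and>
    is_linearization_disk (quadratic_series l) (linearization_disk (quadratic_series l)) \<and>
    linearization_disk f = linearization_disk (quadratic_series l) \<and>
    linearization_disk (quadratic_series l) = ball 0 (linearization_radius (quadratic_series l)) \<and>
    linearization_radius (quadratic_series l) = abs_val (1 - l) powr (- 1 / real p) * r_tilde p l"
proof -
  interpret padic_valued_field p "TYPE('a)"
    using assms(1) by unfold_locales (auto simp: is_complex_padics_def)
  let ?P = "quadratic_series l" and ?s = "root_level p (abs_val (1 - l))"
  define r where "r = abs_val (1 - l) powr (- 1 / real p) * r_tilde p l"
  have rate: "r_tilde p l = small_divisor_rate p ?s l"
    using assms(1,5,3) by (rule r_tilde_eq_small_divisor_rate)
  have level: "abs_val (1 - l ^ (p ^ ?s)) < root_dist p 1"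
    using root_level[of "abs_val (1 - l)"] assms(5) by (intro dist_1_power_tower_below_threshold) auto
  have disk: "is_linearization_disk h (ball 0 r)"
    if "h \<in> indifferent_series l" "abs_val (fps_nth h 2) = 1"
      "abs_val ((fps_nth h 2)\<^sup>2 - fps_nth h 3) = 1" for h
    unfolding r_def rate using assms(2,4,5,3) level that by (rule is_linearization_disk_ball)
  have f: "is_linearization_disk f (ball 0 r)"
    using assms(6-8) by (rule disk)
  have P: "is_linearization_disk ?P (ball 0 r)"
    by (rule disk) (simp_all add: quadratic_series_indifferent)
  have "l \<noteq> 1"
    using assms(3)[rule_format, of 1] by simp
  then have r_pos: "0 < r"
    using small_divisor_rate_pos[OF assms(3)] by (simp add: r_def rate)
  have "linearization_radius ?P = r"
    unfolding linearization_radius_def linearization_disk_eqI[OF P]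
    using r_pos complex_padics_ball_radius_unique[OF assms(1) r_pos] by (intro the_equality) auto
  then show ?thesis
    using f P by (simp add: linearization_disk_eqI[OF f] linearization_disk_eqI[OF P] r_def)
qed

end
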